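(* Let $(\mathbb{P},\leq)$ be a poset and let $\Theta\subseteq\mathcal{P}(\mathbb{P})$ be admissible and directed. Then the regularisation $\Theta^{\mathsf{R}}$ is also admissible and directed, and $$\widehat{\Theta^{\mathsf{R}}}=\{R\subseteq\dot{\mathbb{P}}:R\text{ is a }\Theta\text{-Cauchy }\vartriangleleft\text{-filter}\},$$ where $\vartriangleleft\ =\ \vartriangleleft_\Theta$ and $\dot{\mathbb{P}}$ are computed with respect to $\Theta$. If moreover $\Theta$ is countable, then $\widehat{\Theta^{\mathsf{R}}}$ is completely metrisable.
   Context: For $\Phi\subseteq\mathcal{P}(\mathbb{P})$ and $R,S\subseteq\mathbb{P}$: $R\leq S$ ($R$ refines $S$) means $\forall r\in R\ \exists s\in S\ (r\leq s)$; $R\leq q$ means $r\leq q$ for all $r\in R$; $\Phi^\leq=\{D\subseteq\mathbb{P}:\exists C\in\Phi\ (C\leq D)\}$. $\Phi$ is directed if for every finite (possibly empty) $\mathcal{G}\subseteq\Phi$ there is $C\in\Phi$ with $C\leq D$ for all $D\in\mathcal{G}$ (so $\Phi\neq\emptyset$). Spectrum: $R\subseteq\mathbb{P}$ is $\Phi$-Cauchy if $C\cap R\neq\emptyset$ for all $C\in\Phi$; $\Phi$-round if for every $r\in R$ there is $C\in\Phi$ with $c\leq r$ for all $c\in C\cap R$. $\widehat\Phi$ is the set of all $\Phi$-round $\Phi$-Cauchy ($\leq$-)up-sets $R\subseteq\mathbb{P}$, with the topology having subbasis $(\widehat\Phi_p)_{p\in\mathbb{P}}$, where $\widehat\Phi_p=\{R\in\widehat\Phi:p\in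 R\}$. $S\subseteq\mathbb{P}$ is $\Phi^\leq$-near if there is $D\subseteq\mathbb{P}$ with $D\notin\Phi^\leq$ and $D\cup\{s\}\in\Phi^\leq$ for all $s\in S$. $\dot{\mathbb{P}}=\{p\in\mathbb{P}:\{p\}\text{ is }\Theta^\leq\text{-near}\}$. For $C\subseteq\mathbb{P}$, $p\in\mathbb{P}$, the star (relative to $\Phi$) is $Cp=\{c\in C:\{c,p\}\text{ is }\Phi^\leq\text{-near}\}$. The uniformly below relation: $p\vartriangleleft_\Phi q$ iff there is $C\in\Phi$ with $Cp\leq q$. $\Phi$ is admissible if for every $p\in\mathbb{P}$ the supremum of $\{q\in\mathbb{P}:q\vartriangleleft_\Phi p\}$ exists and equals $p$. With $\vartriangleleft\ =\ \vartriangleleft_\Theta$: $R\subseteq\mathbb{P}$ is a $\vartriangleleft$-filter if for every $F\subseteq\mathbb{P}$, $F$ is a finite subset of $R$ if and only if $F$ is finite and there is $s\in R$ with $s\vartriangleleft f$ for all $f\in F$ (equivalently: $R$ is closed upwards under $\vartriangleleft$, and every finite, possibly empty, subset of $R$ has a $\vartriangleleft$-lower bound in $R$). Regularisation: for $C\subseteq\mathbb{P}$ put $C^\vartriangleright=\{p\in\mathbb{P}:\exists c\in C\ (p\vartriangleleft_\Theta c)\}$. Let $\Theta^1=\Theta$, $\Theta^{n+1}=\{C^\vartriangleright:C\in\Theta^n\}$, and $\Theta^{\mathsf{R}}=\bigcup_{n\geq1}\Theta^n$. *)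

theory Defs
  imports "HOL-Analysis.Analysis" "HOL-Library.Lub_Glb"
begin

text \<open>
  The poset is a carrier \<open>P :: 'a::order set\<close> with the order inherited from the ambient type.
  This includes the empty poset, and no poset is lost up to isomorphism: sending a point of a poset
  to its principal down-set embeds the poset into a powerset type ordered by inclusion.
\<close>

definition refines :: "'a::order set \<Rightarrow> 'a set \<Rightarrow> bool"
  where "refines R S \<longleftrightarrow> (\<forall>r\<in>R. \<exists>s\<in>S. r \<le> s)"

text \<open>The family written \<open>\<Phi>\<^sup>\<le>\<close>.\<close>
definition coarsenings :: "'a::order set \<Rightarrow> 'a set set \<Rightarrow> 'a set set"
  where "coarsenings P \<Phi> = {D. D \<subseteq> P \<and> (\<exists>C\<in>\<Phi>. refines C D)}"

definition directed_family :: "'a::order set set \<Rightarrow> bool"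
  where "directed_family \<Phi> \<longleftrightarrow>
    (\<forall>\<G>. finite \<G> \<and> \<G> \<subseteq> \<Phi> \<longrightarrow> (\<exists>C\<in>\<Phi>. \<forall>D\<in>\<G>. refines C D))"

definition cauchy_wrt :: "'a::order set set \<Rightarrow> 'a set \<Rightarrow> bool"
  where "cauchy_wrt \<Phi> R \<longleftrightarrow> (\<forall>C\<in>\<Phi>. C \<inter> R \<noteq> {})"

definition round_wrt :: "'a::order set set \<Rightarrow> 'a set \<Rightarrow> bool"
  where "round_wrt \<Phi> R \<longleftrightarrow> (\<forall>r\<in>R. \<exists>C\<in>\<Phi>. \<forall>c\<in>C \<inter> R. c \<le> r)"

definition up_set :: "'a::order set \<Rightarrow> 'a set \<Rightarrow> bool"
  where "up_set P R \<longleftrightarrow> R \<subseteq> P \<and> (\<forall>r\<in>R. \<forall>p\<in>P. r \<le> p \<longrightarrow> p \<in> R)"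

definition spectrum :: "'a::order set \<Rightarrow> 'a set set \<Rightarrow> 'a set set"
  where "spectrum P \<Phi> = {R. up_set P R \<and> round_wrt \<Phi> R \<and> cauchy_wrt \<Phi> R}"

text \<open>
  The whole space is added to the subbasis because \<open>topology_generated_by\<close> takes the union of the
  given sets as its underlying space, whereas a subbasis contributes the whole space as an empty
  intersection. (The addition matters only when \<open>\<Phi>\<close> is empty.)
\<close>
definition spectrum_topology :: "'a::order set \<Rightarrow> 'a set set \<Rightarrow> 'a set topology"
  where "spectrum_topology P \<Phi> =
    topology_generated_by (insert (spectrum P \<Phi>) ((\<lambda>p. {R \<in> spectrum P \<Phi>. p \<in> R}) ` P))"

definition near_wrt :: "'a::order set \<Rightarrow> 'a set set \<Rightarrow> 'a set \<Rightarrow> bool"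
  where "near_wrt P \<Phi> S \<longleftrightarrow> S \<subseteq> P \<and>
    (\<exists>D. D \<subseteq> P \<and> D \<notin> coarsenings P \<Phi> \<and> (\<forall>s\<in>S. D \<union> {s} \<in> coarsenings P \<Phi>))"

text \<open>The set written \<open>P\<close> with a dot.\<close>
definition near_points :: "'a::order set \<Rightarrow> 'a set set \<Rightarrow> 'a set"
  where "near_points P \<Theta> = {p \<in> P. near_wrt P \<Theta> {p}}"

definition star :: "'a::order set \<Rightarrow> 'a set set \<Rightarrow> 'a set \<Rightarrow> 'a \<Rightarrow> 'a set"
  where "star P \<Phi> C p = {c \<in> C. near_wrt P \<Phi> {c, p}}"

definition uniformly_below :: "'a::order set \<Rightarrow> 'a set set \<Rightarrow> 'a \<Rightarrow> 'a \<Rightarrow> bool"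
  where "uniformly_below P \<Phi> p q \<longleftrightarrow>
    p \<in> P \<and> q \<in> P \<and> (\<exists>C\<in>\<Phi>. \<forall>c\<in>star P \<Phi> C p. c \<le> q)"

text \<open>In \<open>isLub P A p\<close> the upper bounds range over the carrier \<open>P\<close> only.\<close>
definition admissible_family :: "'a::order set \<Rightarrow> 'a set set \<Rightarrow> bool"
  where "admissible_family P \<Phi> \<longleftrightarrow>
    (\<forall>p\<in>P. isLub P {q \<in> P. uniformly_below P \<Phi> q p} p)"

definition below_filter :: "'a::order set \<Rightarrow> 'a set set \<Rightarrow> 'a set \<Rightarrow> bool"
  where "below_filter P \<Theta> R \<longleftrightarrow> R \<subseteq> P \<and>
    (\<forall>F. F \<subseteq> P \<longrightarrow>
      (finite F \<and> F \<subseteq> R \<longleftrightarrow> finite F \<and> (\<exists>s\<in>R. \<forall>f\<in>F. uniformly_below P \<Theta> s f)))"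

text \<open>The set written \<open>C\<^sup>\<rhd>\<close>.\<close>
definition below_set :: "'a::order set \<Rightarrow> 'a set set \<Rightarrow> 'a set \<Rightarrow> 'a set"
  where "below_set P \<Theta> C = {p \<in> P. \<exists>c\<in>C. uniformly_below P \<Theta> p c}"

text \<open>Indices are shifted by one: \<open>reg_iterate P \<Theta> n\<close> is \<open>\<Theta>\<^bsup>n+1\<^esup>\<close>.\<close>
primrec reg_iterate :: "'a::order set \<Rightarrow> 'a set set \<Rightarrow> nat \<Rightarrow> 'a set set"
  where
    "reg_iterate P \<Theta> 0 = \<Theta>"
  | "reg_iterate P \<Theta> (Suc n) = below_set P \<Theta> ` reg_iterate P \<Theta> n"

definition regularisation :: "'a::order set \<Rightarrow> 'a set set \<Rightarrow> 'a set set"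
  where "regularisation P \<Theta> = (\<Union>n. reg_iterate P \<Theta> n)"

end

theory Submission
  imports Defs
begin

text \<open>
  For an admissible directed family, nearness is a notion of the order alone: a point that is not near
  is uniformly below everything and hence the minimum of the poset, and two points are near if and only
  if some near point lies below both (\<open>near_iff\<close>). Regularised covers still have an element near
  any given near point, so the regularisation has the same near pairs and therefore the same stars
  (\<open>regularisation_near\<close>). Admissibility of the regularisation then reduces to showing that
  a star of \<open>q\<close> in an iterated regularised cover bounded by \<open>p\<close> forces \<open>q \<le> p\<close>; the bound
  can be pushed back one regularisation step at a time, at the price of replacing \<open>q\<close> by a point
  uniformly below it, and \<open>q\<close> is the supremum of those points (\<open>le_of_star_bound\<close>). Directedness
  holds because regularising a cover refines it and preserves refinement between covers.

  A set in the spectrum meets \<open>C\<^sup>\<rhd>\<close> for every cover \<open>C\<close>, and with roundness this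
  yields lower bounds with respect to the uniformly below relation. Conversely, such lower bounds carry
  the Cauchy property from \<open>C\<close> to \<open>C\<^sup>\<rhd>\<close>, and they make any two elements near, which
  gives roundness. Hence the spectrum of the regularisation consists of the stated filters
  (\<open>spectrum_regularisation\<close>).

  If the family is countable, so is its regularisation, and every \<open>R\<close> in the spectrum has a
  decreasing coinitial sequence. The corresponding neighbourhood bases satisfy Frink's condition: for
  all \<open>x\<close> and \<open>n\<close> there is \<open>m\<close> such that \<open>V m y \<subseteq> V n x\<close> whenever \<open>V m y\<close> meets
  \<open>V m x\<close>. Frink's theorem (\<open>completely_metrizable_of_frink_bases\<close>) turns these bases into a sequence
  of star-refining open covers and these into a chain metric. The metric is complete because the
  terms of a Cauchy sequence eventually share, for every cover, an element of it, and any such sequence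
  converges (\<open>regularisation_spectrum_limit\<close>).
\<close>

section \<open>Complete metrisability from neighbourhood bases\<close>

text \<open>
  Frink's chain lemma. Cut the chain at the last place where the part before the cut has at most half
  of the total length \<open>S\<close>. The part after the next link then also has at most half, so by induction
  \<open>f\<close> is at most \<open>S\<close> on both outer parts; it is at most \<open>S\<close> on the link between them,
  and the relaxed triangle inequality for three steps gives \<open>2 * S\<close>.
\<close>
lemma chain_estimate:
  fixes f :: "'b \<Rightarrow> 'b \<Rightarrow> real"
  assumes nonneg: "\<And>x y. 0 \<le> f x y" and refl: "\<And>x. f x x = 0"
    and triple: "\<And>x y z w. f x w \<le> 2 * max (f x y) (max (f y z) (f z w))"
  shows "f (c 0) (c n) \<le> 2 * (\<Sum>i<n. f (c i) (c (Suc i)))"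
proof (induction n arbitrary: c rule: less_induct)
  case (less n)
  define g where "g i = f (c i) (c (Suc i))" for i
  define S where "S = (\<Sum>i<n. g i)"
  have g0: "0 \<le> g i" for i
    by (simp add: g_def nonneg)
  have S0: "0 \<le> S"
    by (simp add: S_def g0 sum_nonneg)
  show ?case
  proof (cases "n = 0")
    case True
    then show ?thesis by (simp add: refl)
  next
    case False
    define J where "J = {j. j < n \<and> (\<Sum>i<j. g i) \<le> S / 2}"
    have "finite J" "0 \<in> J"
      using False S0 by (auto simp: J_def)
    define j where "j = Max J"
    have "j \<in> J"
      using \<open>finite J\<close> \<open>0 \<in> J\<close> Max_in unfolding j_def by blast
    then have j: "j < n" "(\<Sum>i<j. g i) \<le> S / 2"
      by (auto simp: J_def)
    have "Suc j \<notin> J"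
      using Max_ge[OF \<open>finite J\<close>, of "Suc j"] by (auto simp: j_def)
    have split: "S = (\<Sum>i<Suc j. g i) + (\<Sum>i<n - Suc j. g (Suc j + i))"
    proof -
      have "(\<Sum>i<Suc j + k. g i) = (\<Sum>i<Suc j. g i) + (\<Sum>i<k. g (Suc j + i))" for k
        by (induction k) (simp_all add: add.assoc)
      from this[of "n - Suc j"] show ?thesis
        using j(1) by (simp add: S_def)
    qed
    have tail: "(\<Sum>i<n - Suc j. g (Suc j + i)) \<le> S / 2"
    proof (cases "Suc j = n")
      case True
      then show ?thesis using S0 by simp
    next
      case False
      then have "(\<Sum>i<Suc j. g i) > S / 2"
        using \<open>Suc j \<notin> J\<close> j(1) by (auto simp: J_def)
      then show ?thesis using split by linarith
    qed
    have "f (c 0) (c j) \<le> 2 * (\<Sum>i<j. g i)"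
      using less.IH[OF j(1), of c] by (simp add: g_def)
    then have 1: "f (c 0) (c j) \<le> S"
      using j(2) by linarith
    have 2: "f (c j) (c (Suc j)) \<le> S"
      unfolding S_def using j(1) g0 member_le_sum[of j "{..<n}" g] by (simp add: g_def)
    have "f (c (Suc j + 0)) (c (Suc j + (n - Suc j))) \<le> 2 * (\<Sum>i<n - Suc j. g (Suc j + i))"
      using less.IH[of "n - Suc j" "\<lambda>i. c (Suc j + i)"] j(1) by (simp add: g_def)
    then have 3: "f (c (Suc j)) (c n) \<le> S"
      using tail j(1) by simp
    have "f (c 0) (c n) \<le> 2 * S"
      using triple[of "c 0" "c n" "c j" "c (Suc j)"] 1 2 3 by linarith
    then show ?thesis by (simp add: S_def g_def)
  qed
qed

text \<open>
  The infimum of the lengths of all chains from \<open>x\<close> to \<open>y\<close> satisfies the triangle inequality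
  because chains can be concatenated; the chain lemma keeps it from collapsing.
\<close>
lemma chain_metric:
  fixes f :: "'b \<Rightarrow> 'b \<Rightarrow> real"
  assumes nonneg: "\<And>x y. 0 \<le> f x y" and refl: "\<And>x. f x x = 0"
    and sym: "\<And>x y. f x y = f y x"
    and triple: "\<And>x y z w. f x w \<le> 2 * max (f x y) (max (f y z) (f z w))"
  obtains d :: "'b \<Rightarrow> 'b \<Rightarrow> real"
  where "\<And>x y. 0 \<le> d x y" "\<And>x. d x x = 0" "\<And>x y. d x y = d y x"
    "\<And>x y z. d x z \<le> d x y + d y z"
    "\<And>x y. d x y \<le> f x y" "\<And>x y. f x y \<le> 2 * d x y"
proof -
  define len where "len c n = (\<Sum>i<n. f (c i) (c (Suc i)))" for c :: "nat \<Rightarrow> 'b" and n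
  define L where "L x y = {len c n | c n. c 0 = x \<and> c n = y}" for x y
  define d where "d x y = Inf (L x y)" for x y
  have len0: "0 \<le> len c n" for c n
    by (simp add: len_def nonneg sum_nonneg)
  have bdd: "bdd_below (L x y)" for x y
    by (rule bdd_belowI[of _ 0]) (auto simp: L_def len0)
  have fL: "f x y \<in> L x y" for x y
    unfolding L_def
    by (rule CollectI, rule exI[of _ "\<lambda>i. if i = 0 then x else y"], rule exI[of _ 1])
       (simp add: len_def)
  have dlen: "d (c 0) (c n) \<le> len c n" for c n
    unfolding d_def by (rule cInf_lower[OF _ bdd]) (auto simp: L_def)
  have appr: "\<exists>c n. c 0 = x \<and> c n = y \<and> len c n < e" if "d x y < e" for x y e
  proof -
    have "\<exists>l\<in>L x y. l < e"
      using that cInf_lessD[of "L x y" e] fL unfolding d_def by blast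
    then show ?thesis by (auto simp: L_def)
  qed
  have df: "d x y \<le> f x y" for x y
    unfolding d_def by (rule cInf_lower[OF fL bdd])
  have d0: "0 \<le> d x y" for x y
    unfolding d_def
  proof (rule cInf_greatest)
    show "L x y \<noteq> {}"
      using fL by blast
  qed (auto simp: L_def len0)
  have fd: "f x y \<le> 2 * d x y" for x y
  proof -
    have "f x y / 2 \<le> d x y"
      unfolding d_def
    proof (rule cInf_greatest)
      fix l assume "l \<in> L x y"
      then obtain c n where "l = len c n" "c 0 = x" "c n = y"
        by (auto simp: L_def)
      then show "f x y / 2 \<le> l"
        using chain_estimate[of f c n, OF nonneg refl triple] by (simp add: len_def)
    qed (use fL in blast)
    then show ?thesis by linarith
  qed
  have ds: "d y x \<le> d x y" for x y
  proof (rule field_le_epsilon)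
    fix e :: real assume "0 < e"
    then obtain c n where c: "c 0 = x" "c n = y" "len c n < d x y + e"
      using appr[of x y "d x y + e"] by auto
    have "len (\<lambda>i. c (n - i)) n = (\<Sum>i<n. f (c (n - Suc i)) (c (Suc (n - Suc i))))"
      unfolding len_def by (rule sum.cong) (auto simp: sym Suc_diff_Suc)
    also have "\<dots> = len c n"
      unfolding len_def by (rule sum.nat_diff_reindex)
    finally show "d y x \<le> d x y + e"
      using dlen[of "\<lambda>i. c (n - i)" n] c by simp
  qed
  have tri: "d x z \<le> d x y + d y z" for x y z
  proof (rule field_le_epsilon)
    fix e :: real assume "0 < e"
    then obtain c m where c: "c 0 = x" "c m = y" "len c m < d x y + e / 2"
      using appr[of x y "d x y + e / 2"] by auto
    obtain c' n where c': "c' 0 = y" "c' n = z" "len c' n < d y z + e / 2"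
      using appr[of y z "d y z + e / 2"] \<open>0 < e\<close> by auto
    define b where "b i = (if i \<le> m then c i else c' (i - m))" for i
    have b': "b (m + i) = c' i" for i
      using c(2) c'(1) by (cases "i = 0") (auto simp: b_def)
    have "len b (m + k) = len c m + len c' k" for k
    proof (induction k)
      case 0
      show ?case
        unfolding len_def by (simp, rule sum.cong) (auto simp: b_def)
    next
      case (Suc k)
      have "len b (m + Suc k) = len b (m + k) + f (b (m + k)) (b (m + Suc k))"
        by (simp add: len_def)
      with Suc show ?case by (simp only: b') (simp add: len_def)
    qed
    then have "d (b 0) (b (m + n)) \<le> len c m + len c' n"
      using dlen[of b "m + n"] by simp
    moreover have "b 0 = x" "b (m + n) = z"
      using c c' b' by (auto simp: b_def)
    ultimately show "d x z \<le> d x y + d y z + e"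
      using c c' by simp
  qed
  show thesis
  proof (rule that[of d])
    show "d x x = 0" for x
      using df[of x x] d0[of x x] by (simp add: refl)
    show "d x y = d y x" for x y
      using ds[of x y] ds[of y x] by simp
  qed (fact d0 tri df fd)+
qed

text \<open>
  The metrisation of a uniformity with a countable base: \<open>f x y = (1/2) ^ k\<close> for the last \<open>k\<close>
  at which \<open>x\<close> and \<open>y\<close> are still related is a distance up to the factor 2 that the chain
  construction corrects.
\<close>
lemma pseudometric_of_entourages:
  fixes E :: "nat \<Rightarrow> 'b \<Rightarrow> 'b \<Rightarrow> bool"
  assumes E0: "\<And>x y. E 0 x y" and refl: "\<And>k x. E k x x"
    and sym: "\<And>k x y. E k x y \<Longrightarrow> E k y x"
    and triple: "\<And>k x y z w. E (Suc k) x y \<Longrightarrow> E (Suc k) y z \<Longrightarrow> E (Suc k) z w \<Longrightarrow> E k x w"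
  obtains d :: "'b \<Rightarrow> 'b \<Rightarrow> real"
  where "\<And>x y. 0 \<le> d x y" "\<And>x. d x x = 0" "\<And>x y. d x y = d y x"
    "\<And>x y z. d x z \<le> d x y + d y z"
    "\<And>k x y. E k x y \<Longrightarrow> d x y \<le> (1/2) ^ k"
    "\<And>k x y. d x y < (1/2) ^ Suc k \<Longrightarrow> E k x y"
proof -
  have anti: "E k x y" if "E j x y" "k \<le> j" for j k x y
    using that(2,1) by (induction rule: dec_induct) (use triple refl in blast)+
  define f where "f x y = (if \<forall>k. E k x y then 0 else (1/2::real) ^ ((LEAST k. \<not> E k x y) - 1))"
    for x y
  have f_cases: "f x y = 0 \<and> (\<forall>k. E k x y) \<or> (\<exists>j. f x y = (1/2) ^ j \<and> (\<forall>k. E k x y \<longleftrightarrow> k \<le> j))"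
    for x y
  proof (cases "\<forall>k. E k x y")
    case False
    define l where "l = (LEAST k. \<not> E k x y)"
    have l: "\<not> E l x y"
      using False unfolding l_def by (metis (mono_tags, lifting) LeastI)
    have below: "E k x y" if "k < l" for k
      using not_less_Least that unfolding l_def by blast
    have "l \<noteq> 0"
      using l E0 by metis
    have iff: "E k x y \<longleftrightarrow> k < l" for k
    proof (cases "k < l")
      case False
      then have "\<not> E k x y"
        using l anti[of k x y l] by auto
      then show ?thesis using False by simp
    qed (simp add: below)
    have "E k x y \<longleftrightarrow> k \<le> l - 1" for k
      unfolding iff using \<open>l \<noteq> 0\<close> by linarith
    then have "\<forall>k. E k x y \<longleftrightarrow> k \<le> l - 1" ..
    moreover have "f x y = (1/2) ^ (l - 1)"
      using False by (simp add: f_def l_def)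
    ultimately show ?thesis
      by (intro disjI2 exI[of _ "l - 1"] conjI)
  qed (simp add: f_def)
  have f_le: "f x y \<le> (1/2) ^ k \<longleftrightarrow> E k x y" for x y k
  proof -
    have "(1/2::real) ^ j \<le> (1/2) ^ k \<longleftrightarrow> k \<le> j" for j
      by (rule power_decreasing_iff) auto
    then show ?thesis
      using f_cases[of x y] by (metis half_gt_zero zero_le_power zero_less_one less_imp_le)
  qed
  have f0: "0 \<le> f x y" for x y
    by (simp add: f_def)
  have frefl: "f x x = 0" for x
    by (simp add: f_def refl)
  have fsym: "f x y = f y x" for x y
  proof -
    have "E k x y \<longleftrightarrow> E k y x" for k
      using sym by blast
    then show ?thesis
      by (simp add: f_def)
  qed
  have ftriple: "f x w \<le> 2 * max (f x y) (max (f y z) (f z w))" for x y z w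
  proof -
    define m where "m = max (f x y) (max (f y z) (f z w))"
    have le: "f x y \<le> m" "f y z \<le> m" "f z w \<le> m"
      by (auto simp: m_def)
    have step: "f x w \<le> (1/2) ^ k" if "m \<le> (1/2) ^ Suc k" for k
    proof -
      have "E (Suc k) x y" "E (Suc k) y z" "E (Suc k) z w"
        using le that by (simp_all only: f_le[symmetric])
      then show ?thesis
        unfolding f_le by (rule triple)
    qed
    have "m \<in> {f x y, f y z, f z w}"
      by (auto simp: m_def max_def)
    then consider "m = 0" | j where "m = (1/2) ^ j"
      using f_cases[of x y] f_cases[of y z] f_cases[of z w] by (metis insertE singletonD)
    then show ?thesis
    proof cases
      case 1
      then have "\<forall>k. E k x w"
        using step f_le by simp
      then show ?thesis
        using 1 by (simp add: f_def m_def)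
    next
      case 2
      show ?thesis
      proof (cases j)
        case 0
        then show ?thesis
          using 2 f_le[of x w 0] E0 m_def by simp
      next
        case (Suc i)
        then show ?thesis
          using 2 step[of i] m_def by simp
      qed
    qed
  qed
  obtain d where d: "\<And>x y. 0 \<le> d x y" "\<And>x. d x x = 0" "\<And>x y. d x y = d y x"
      "\<And>x y z. d x z \<le> d x y + d y z"
      "\<And>x y. d x y \<le> f x y" "\<And>x y. f x y \<le> 2 * d x y"
    by (rule chain_metric[of f, OF f0 frefl fsym ftriple]) (rule that; assumption)
  show thesis
  proof (rule that[of d])
    show "d x y \<le> (1/2) ^ k" if "E k x y" for k x y
      using that d(5)[of x y] f_le[of x y k] by linarith
    show "E k x y" if "d x y < (1/2) ^ Suc k" for k x y
      using that d(6)[of x y] f_le[of x y k] by simp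
  qed (fact d)+
qed

text \<open>
  The Alexandroff--Urysohn metrisation theorem, with completeness. Lying in a common member of
  \<open>G k\<close> is the \<open>k\<close>-th entourage. That the whole star of a point, and not merely any two members
  containing it, lies in one member of the previous cover matters for completeness: the tail of a
  Cauchy sequence lies in the star of one of its terms, hence eventually in a single member of each
  cover, which is what the assumption on convergence asks for.
\<close>
lemma completely_metrizable_of_star_refining_covers:
  fixes X :: "'b topology" and G :: "nat \<Rightarrow> 'b set set"
  assumes "open": "\<And>k A. A \<in> G k \<Longrightarrow> openin X A"
    and cover: "\<And>k. topspace X \<subseteq> \<Union>(G k)"
    and star: "\<And>k x. x \<in> topspace X \<Longrightarrow> \<exists>C\<in>G k. \<forall>A\<in>G (Suc k). x \<in> A \<longrightarrow> A \<subseteq> C"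
    and base: "\<And>W x. openin X W \<Longrightarrow> x \<in> W \<Longrightarrow> \<exists>k. \<forall>A\<in>G k. x \<in> A \<longrightarrow> A \<subseteq> W"
    and t0: "t0_space X"
    and complete: "\<And>\<sigma> :: nat \<Rightarrow> 'b. range \<sigma> \<subseteq> topspace X \<Longrightarrow>
        (\<And>k. \<exists>A\<in>G k. \<forall>\<^sub>F n in sequentially. \<sigma> n \<in> A) \<Longrightarrow> \<exists>l. limitin X \<sigma> l sequentially"
  shows "completely_metrizable_space X"
proof -
  define D where "D k x y \<longleftrightarrow> x = y \<or> (\<exists>A\<in>G k. x \<in> A \<and> y \<in> A)" for k x y
  have G_top: "x \<in> topspace X" if "A \<in> G k" "x \<in> A" for A k x
    using openin_subset[OF "open"[OF that(1)]] that(2) by blast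
  have D_refl: "D k x x" for k x
    by (simp add: D_def)
  have D_sym: "D k x y \<Longrightarrow> D k y x" for k x y
    by (auto simp: D_def)
  have D_common: "D k x z" if A: "A \<in> G (Suc k)" "x \<in> A" "y \<in> A" and B: "B \<in> G (Suc k)" "y \<in> B" "z \<in> B"
    for k x y z A B
  proof -
    obtain C where C: "C \<in> G k" "\<forall>A\<in>G (Suc k). y \<in> A \<longrightarrow> A \<subseteq> C"
      using star[OF G_top[OF A(1,3)], of k] by blast
    then have "A \<subseteq> C" "B \<subseteq> C"
      using A(1,3) B(1,2) by auto
    then show ?thesis
      unfolding D_def using C(1) A(2) B(3) by blast
  qed
  have D_Suc: "D k x y" if xy: "D (Suc k) x y" for k x y
  proof (cases "x = y")
    case False
    then obtain A where "A \<in> G (Suc k)" "x \<in> A" "y \<in> A"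
      using xy by (auto simp: D_def)
    then show ?thesis
      by (intro D_common[of A k x y A y])
  qed (simp add: D_refl)
  have D_two: "D k x z" if xyz: "D (Suc k) x y" "D (Suc k) y z" for k x y z
  proof -
    consider "x = y" | "y = z" | A B where "A \<in> G (Suc k)" "x \<in> A" "y \<in> A" "B \<in> G (Suc k)" "y \<in> B" "z \<in> B"
      using xyz unfolding D_def by blast
    then show ?thesis
    proof cases
      case 3
      then show ?thesis by (rule D_common)
    qed (use xyz D_Suc in auto)
  qed
  have D_anti: "D k x y" if "D j x y" "k \<le> j" for j k x y
    using that(2,1) by (induction rule: dec_induct) (use D_Suc in blast)+
  have D_W: "\<exists>k. \<forall>y. D k x y \<longrightarrow> y \<in> W" if W: "openin X W" "x \<in> W" for W x
  proof -
    obtain k where "\<forall>A\<in>G k. x \<in> A \<longrightarrow> A \<subseteq> W"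
      using base[OF W] by blast
    then have "y \<in> W" if "D k x y" for y
      using that W(2) by (auto simp: D_def)
    then show ?thesis by blast
  qed
  \<comment> \<open>Composing three relations takes two levels of covers, hence the factor 2; level 0 is the total
    relation because the first cover need not relate all points.\<close>
  define E where "E k x y \<longleftrightarrow> k = 0 \<or> D (2 * k) x y" for k x y
  have E_triple: "E k x w" if "E (Suc k) x y" "E (Suc k) y z" "E (Suc k) z w" for k x y z w
  proof -
    have "D (Suc (Suc (2 * k))) x y" "D (Suc (Suc (2 * k))) y z" "D (Suc (Suc (2 * k))) z w"
      using that by (auto simp: E_def)
    then show ?thesis
      unfolding E_def using D_two D_Suc by blast
  qed
  have E0: "E 0 x y" and E_refl: "E k x x" and E_sym: "E k x y \<Longrightarrow> E k y x" for k x y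
    using D_refl D_sym by (auto simp: E_def)
  obtain d :: "'b \<Rightarrow> 'b \<Rightarrow> real"
    where d: "\<And>x y. 0 \<le> d x y" "\<And>x. d x x = 0" "\<And>x y. d x y = d y x"
      "\<And>x y z. d x z \<le> d x y + d y z"
      "\<And>k x y. E k x y \<Longrightarrow> d x y \<le> (1/2) ^ k"
      "\<And>k x y. d x y < (1/2) ^ Suc k \<Longrightarrow> E k x y"
    by (rule pseudometric_of_entourages[of E])
      (rule E0 | rule E_refl | rule E_sym, assumption | rule E_triple, assumption+
        | (rule that; assumption))+
  have d_D: "D k x y" if "d x y < (1/2) ^ Suc (Suc k)" for k x y
    using d(6)[OF that] D_anti[of "2 * Suc k" x y k] by (simp add: E_def)
  have zero: "x = y" if "x \<in> topspace X" "y \<in> topspace X" "d x y = 0" for x y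
  proof (rule ccontr)
    assume "x \<noteq> y"
    then obtain W where "openin X W" and W: "x \<notin> W \<longleftrightarrow> y \<in> W"
      using t0 \<open>x \<in> topspace X\<close> \<open>y \<in> topspace X\<close> unfolding t0_space_def by metis
    have "D k x y" for k
      using d_D[of x y k] that(3) by simp
    then show False
      using D_W[OF \<open>openin X W\<close>] D_sym W by blast
  qed
  interpret Metric_space "topspace X" d
    by unfold_locales (use d(1,2) zero in auto, rule d(3), rule d(4))
  have "mtopology = X"
  proof (rule topology_eq[THEN iffD2], intro allI iffI)
    fix W assume W: "openin mtopology W"
    have "\<exists>A. openin X A \<and> x \<in> A \<and> A \<subseteq> W" if xW: "x \<in> W" for x
    proof -
      obtain r where r: "r > 0" "mball x r \<subseteq> W"
        using W xW by (auto simp: openin_mtopology)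
      obtain k where "(1/2) ^ k < r"
        using real_arch_pow_inv[OF r(1), of "1/2"] by auto
      then have k: "(1/2) ^ Suc k < r"
        using zero_less_power[of "1/2::real" k] by (simp only: power_Suc) linarith
      have x: "x \<in> topspace X"
        using W xW by (auto simp: openin_mtopology)
      obtain A where A: "A \<in> G (2 * Suc k)" "x \<in> A"
        using cover[of "2 * Suc k"] x by blast
      have "A \<subseteq> mball x r"
      proof
        fix y assume y: "y \<in> A"
        have "E (Suc k) x y"
          using A y by (auto simp: E_def D_def)
        then have "d x y < r"
          using d(5) k by fastforce
        then show "y \<in> mball x r"
          using G_top[OF A(1)] x y by simp
      qed
      then show ?thesis
        using A(2) "open"[OF A(1)] r(2) by (intro exI[of _ A]) auto
    qed
    then show "openin X W"
      using openin_subopen by blast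
  next
    fix W assume W: "openin X W"
    show "openin mtopology W"
      unfolding openin_mtopology
    proof (intro conjI allI impI)
      show "W \<subseteq> topspace X"
        using W by (rule openin_subset)
      fix x assume "x \<in> W"
      then obtain k where k: "\<forall>y. D k x y \<longrightarrow> y \<in> W"
        using D_W[OF W] by blast
      have "mball x ((1/2) ^ Suc (Suc k)) \<subseteq> W"
        using d_D k by auto
      then show "\<exists>r>0. mball x r \<subseteq> W"
        by (metis zero_less_power half_gt_zero_iff zero_less_one)
    qed
  qed
  moreover have mcomplete
    unfolding mcomplete_def
  proof (intro allI impI)
    fix \<sigma> assume \<sigma>: "MCauchy \<sigma>"
    have "\<exists>l. limitin X \<sigma> l sequentially"
    proof (rule complete)
      show "range \<sigma> \<subseteq> topspace X"
        using \<sigma> by (simp add: MCauchy_def)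
      fix k
      have pos: "(0::real) < (1/2) ^ Suc (Suc (Suc k))"
        by simp
      obtain N where N: "\<And>m n. N \<le> m \<Longrightarrow> N \<le> n \<Longrightarrow> d (\<sigma> m) (\<sigma> n) < (1/2) ^ Suc (Suc (Suc k))"
        using \<sigma>[unfolded MCauchy_def, THEN conjunct2, rule_format, OF pos] by blast
      have \<sigma>N: "\<sigma> N \<in> topspace X"
        using \<sigma> by (auto simp: MCauchy_def)
      obtain C where C: "C \<in> G k" "\<forall>A\<in>G (Suc k). \<sigma> N \<in> A \<longrightarrow> A \<subseteq> C"
        using star[OF \<sigma>N, of k] by blast
      obtain A where "A \<in> G (Suc k)" "\<sigma> N \<in> A"
        using cover[of "Suc k"] \<sigma>N by blast
      then have "\<sigma> N \<in> C"
        using C(2) by auto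
      have "\<sigma> n \<in> C" if "N \<le> n" for n
        using d_D[OF N[OF order_refl that]] C(2) \<open>\<sigma> N \<in> C\<close> by (auto simp: D_def)
      then show "\<exists>A\<in>G k. \<forall>\<^sub>F n in sequentially. \<sigma> n \<in> A"
        using C(1) unfolding eventually_sequentially by blast
    qed
    then show "\<exists>x. limitin mtopology \<sigma> x sequentially"
      by (simp add: \<open>mtopology = X\<close>)
  qed
  ultimately show ?thesis
    unfolding completely_metrizable_space_def using Metric_space_axioms by metis
qed

text \<open>
  Frink's metrisation theorem, with completeness. The index \<open>m\<close> in Frink's condition depends on the
  point, so the covers by all \<open>V n x\<close> with \<open>n\<close> fixed need not star-refine one another. The remedy
  is to let each point move through its own base at its own speed: iterating \<open>n \<mapsto> m n x\<close> gives
  indices \<open>lev x k\<close>, and the sets \<open>V (lev x k) x\<close> for fixed \<open>k\<close> form covers that do.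
\<close>
lemma completely_metrizable_of_frink_bases:
  fixes X :: "'b topology" and V :: "nat \<Rightarrow> 'b \<Rightarrow> 'b set"
  assumes "open": "\<And>n x. x \<in> topspace X \<Longrightarrow> openin X (V n x) \<and> x \<in> V n x"
    and dec: "\<And>n x. x \<in> topspace X \<Longrightarrow> V (Suc n) x \<subseteq> V n x"
    and base: "\<And>W x. openin X W \<Longrightarrow> x \<in> W \<Longrightarrow> \<exists>n. V n x \<subseteq> W"
    and frink: "\<And>n x. x \<in> topspace X \<Longrightarrow>
        \<exists>m. \<forall>y\<in>topspace X. V m x \<inter> V m y \<noteq> {} \<longrightarrow> V m y \<subseteq> V n x"
    and t0: "t0_space X"
    and complete: "\<And>\<sigma> :: nat \<Rightarrow> 'b. range \<sigma> \<subseteq> topspace X \<Longrightarrow>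
        (\<And>k. \<exists>x\<in>topspace X. \<forall>\<^sub>F n in sequentially. \<sigma> n \<in> V k x) \<Longrightarrow>
        \<exists>l. limitin X \<sigma> l sequentially"
  shows "completely_metrizable_space X"
proof -
  let ?T = "topspace X"
  have anti: "V j x \<subseteq> V i x" if "i \<le> j" "x \<in> ?T" for i j x
    using that by (induction rule: dec_induct) (use dec in blast)+
  have ex: "\<exists>m>n. \<forall>y\<in>?T. V m x \<inter> V m y \<noteq> {} \<longrightarrow> V m y \<subseteq> V n x"
    if x: "x \<in> ?T" for n x
  proof -
    obtain m where m: "\<forall>y\<in>?T. V m x \<inter> V m y \<noteq> {} \<longrightarrow> V m y \<subseteq> V n x"
      using frink[OF x] by blast
    let ?m = "max m (Suc n)"
    have "V ?m y \<subseteq> V n x" if y: "y \<in> ?T" "V ?m x \<inter> V ?m y \<noteq> {}" for y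
    proof -
      have sub: "V ?m x \<subseteq> V m x" "V ?m y \<subseteq> V m y"
        using anti x y(1) by auto
      then have "V m x \<inter> V m y \<noteq> {}"
        using y(2) by blast
      then show ?thesis
        using m y(1) sub by blast
    qed
    moreover have "n < ?m"
      by simp
    ultimately show ?thesis by blast
  qed
  define m where "m n x = (SOME m. n < m \<and>
      (\<forall>y\<in>?T. V m x \<inter> V m y \<noteq> {} \<longrightarrow> V m y \<subseteq> V n x))" for n x
  have m_gt: "n < m n x"
    and m_all: "\<forall>y\<in>?T. V (m n x) x \<inter> V (m n x) y \<noteq> {} \<longrightarrow> V (m n x) y \<subseteq> V n x"
    if "x \<in> ?T" for n x
    using someI_ex[OF ex[OF that, of n]] unfolding m_def by blast+
  have m: "V (m n x) y \<subseteq> V n x"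
    if "x \<in> ?T" "y \<in> ?T" "V (m n x) x \<inter> V (m n x) y \<noteq> {}" for n x y
    using m_all that by blast
  define lev where "lev x k = rec_nat 0 (\<lambda>_ l. m l x) k" for x k
  have lev_Suc: "lev x (Suc k) = m (lev x k) x" for x k
    by (simp add: lev_def)
  have lev_ge: "k \<le> lev x k" if "x \<in> ?T" for x k
  proof (induction k)
    case (Suc k)
    then show ?case
      using m_gt[OF that, of "lev x k"] by (simp add: lev_Suc)
  qed simp
  define U where "U k x = V (lev x k) x" for k x
  have U_V: "U k x \<subseteq> V k x" if "x \<in> ?T" for k x
    unfolding U_def using anti lev_ge that by blast
  show ?thesis
  proof (rule completely_metrizable_of_star_refining_covers[where G = "\<lambda>k. U k ` ?T"])
    show "openin X A" if "A \<in> U k ` ?T" for k A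
      using that "open" by (auto simp: U_def)
    show "?T \<subseteq> \<Union> (U k ` ?T)" for k
      using "open" by (auto simp: U_def)
    show "\<exists>C\<in>U k ` ?T. \<forall>A\<in>U (Suc k) ` ?T. x \<in> A \<longrightarrow> A \<subseteq> C" if "x \<in> ?T" for k x
    proof -
      \<comment> \<open>Among the sets of the finer cover that contain \<open>x\<close>, take one of least index: its centre
        \<open>s\<close> absorbs all the others.\<close>
      have "x \<in> ?T \<and> x \<in> U (Suc k) x"
        using that "open" by (simp add: U_def)
      then obtain s where s: "s \<in> ?T" "x \<in> U (Suc k) s"
        and least: "\<And>t. t \<in> ?T \<Longrightarrow> x \<in> U (Suc k) t \<Longrightarrow> lev s (Suc k) \<le> lev t (Suc k)"
        using ex_has_least_nat[of "\<lambda>s. s \<in> ?T \<and> x \<in> U (Suc k) s" x "\<lambda>s. lev s (Suc k)"] by blast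
      have "U (Suc k) t \<subseteq> U k s" if t: "t \<in> ?T" "x \<in> U (Suc k) t" for t
      proof -
        have sub: "U (Suc k) t \<subseteq> V (lev s (Suc k)) t"
          unfolding U_def using anti least t by blast
        then have "V (lev s (Suc k)) s \<inter> V (lev s (Suc k)) t \<noteq> {}"
          using s t by (auto simp: U_def)
        then have "V (lev s (Suc k)) t \<subseteq> U k s"
          using m[OF s(1) t(1)] by (simp add: lev_Suc U_def)
        then show ?thesis
          using sub by blast
      qed
      then show ?thesis
        using s(1) by blast
    qed
    show "\<exists>k. \<forall>A\<in>U k ` ?T. x \<in> A \<longrightarrow> A \<subseteq> W" if W: "openin X W" "x \<in> W" for W x
    proof -
      have x: "x \<in> ?T"
        using W openin_subset by blast
      obtain n where n: "V n x \<subseteq> W"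
        using base W by blast
      have "U (m n x) t \<subseteq> W" if t: "t \<in> ?T" "x \<in> U (m n x) t" for t
      proof -
        have "V (m n x) x \<inter> V (m n x) t \<noteq> {}"
          using "open" x U_V t by blast
        then show ?thesis
          using m[OF x t(1)] U_V[OF t(1)] n by blast
      qed
      then show ?thesis by blast
    qed
    show "\<exists>l. limitin X \<sigma> l sequentially"
      if "range \<sigma> \<subseteq> ?T" and ev: "\<And>k. \<exists>A\<in>U k ` ?T. \<forall>\<^sub>F n in sequentially. \<sigma> n \<in> A"
      for \<sigma> :: "nat \<Rightarrow> 'b"
    proof (rule complete[OF that(1)])
      fix k
      obtain x where x: "x \<in> ?T" "\<forall>\<^sub>F n in sequentially. \<sigma> n \<in> U k x"
        using ev by blast
      have "\<forall>\<^sub>F n in sequentially. \<sigma> n \<in> V k x"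
        using x(2) by (rule eventually_mono) (use U_V[OF x(1)] in blast)
      then show "\<exists>x\<in>?T. \<forall>\<^sub>F n in sequentially. \<sigma> n \<in> V k x"
        using x(1) by blast
    qed
  qed (fact t0)
qed

section \<open>Refinement, nearness and stars\<close>

lemma refines_refl: "refines C C"
  by (auto simp: refines_def)

lemma refines_trans: "refines C D \<Longrightarrow> refines D E \<Longrightarrow> refines C E"
  unfolding refines_def by (meson order_trans)

lemma directed_family_iff:
  "directed_family \<Phi> \<longleftrightarrow>
    \<Phi> \<noteq> {} \<and> (\<forall>C\<in>\<Phi>. \<forall>D\<in>\<Phi>. \<exists>E\<in>\<Phi>. refines E C \<and> refines E D)" (is "?L \<longleftrightarrow> ?R")
proof
  assume L: ?L
  show ?R
  proof (intro conjI ballI)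
    show "\<Phi> \<noteq> {}"
      using L[unfolded directed_family_def, rule_format, of "{}"] by auto
    fix C D assume "C \<in> \<Phi>" "D \<in> \<Phi>"
    then show "\<exists>E\<in>\<Phi>. refines E C \<and> refines E D"
      using L[unfolded directed_family_def, rule_format, of "{C, D}"] by auto
  qed
next
  assume R: ?R
  have "\<exists>C\<in>\<Phi>. \<forall>D\<in>\<G>. refines C D" if "finite \<G>" "\<G> \<subseteq> \<Phi>" for \<G>
    using that
  proof (induction \<G> rule: finite_induct)
    case empty
    then show ?case using R by auto
  next
    case (insert B \<G>)
    then obtain C where C: "C \<in> \<Phi>" "\<forall>D\<in>\<G>. refines C D" by auto
    obtain E where "E \<in> \<Phi>" "refines E B" "refines E C"
      using R insert.prems C(1) by (metis insert_subset)
    then show ?case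
      using C(2) refines_trans by blast
  qed
  then show ?L
    by (auto simp: directed_family_def)
qed

lemma near_wrt_mono:
  assumes "near_wrt P \<Phi> {c, p}" "c \<le> c'" "p \<le> p'" "c' \<in> P" "p' \<in> P"
  shows "near_wrt P \<Phi> {c', p'}"
proof -
  have up: "D \<union> {s'} \<in> coarsenings P \<Phi>" if s: "D \<union> {s} \<in> coarsenings P \<Phi>" "s \<le> s'" "s' \<in> P" for D s s'
  proof -
    obtain C where "C \<in> \<Phi>" "refines C (D \<union> {s})"
      using s(1) unfolding coarsenings_def by blast
    moreover have "refines (D \<union> {s}) (D \<union> {s'})"
      using s(2) by (auto simp: refines_def)
    ultimately have "refines C (D \<union> {s'})"
      by (blast intro: refines_trans)
    then show ?thesis
      using s(1,3) \<open>C \<in> \<Phi>\<close> by (auto simp: coarsenings_def)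
  qed
  obtain D where "D \<subseteq> P" "D \<notin> coarsenings P \<Phi>" "D \<union> {c} \<in> coarsenings P \<Phi>" "D \<union> {p} \<in> coarsenings P \<Phi>"
    using assms(1) by (auto simp: near_wrt_def)
  then show ?thesis
    using up assms(2-5) unfolding near_wrt_def by blast
qed

lemma near_points_near: "near_wrt P \<Phi> {c, p} \<Longrightarrow> c \<in> near_points P \<Phi> \<and> p \<in> near_points P \<Phi>"
  unfolding near_points_def by (auto simp: near_wrt_def)

lemma near_points_self: "p \<in> near_points P \<Phi> \<longleftrightarrow> near_wrt P \<Phi> {p, p}"
  by (auto simp: near_points_def near_wrt_def)

lemma near_of_lower_bound:
  "r \<in> near_points P \<Phi> \<Longrightarrow> r \<le> c \<Longrightarrow> r \<le> p \<Longrightarrow> c \<in> P \<Longrightarrow> p \<in> P \<Longrightarrow> near_wrt P \<Phi> {c, p}"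
  using near_wrt_mono near_points_self by metis

lemma near_points_subset: "near_points P \<Phi> \<subseteq> P"
  by (auto simp: near_points_def)

lemma star_bound_refine:
  assumes "\<forall>c\<in>star P \<Phi> C p. c \<le> q" "refines C' C" "C \<subseteq> P" "p \<in> P" "p' \<le> p"
  shows "\<forall>c\<in>star P \<Phi> C' p'. c \<le> q"
proof
  fix c' assume c': "c' \<in> star P \<Phi> C' p'"
  then obtain c where c: "c \<in> C" "c' \<le> c"
    using assms(2) by (auto simp: star_def refines_def)
  then have "near_wrt P \<Phi> {c, p}"
    using c' assms near_wrt_mono[of P \<Phi> c' p' c p] by (auto simp: star_def)
  then show "c' \<le> q"
    using assms(1) c by (auto simp: star_def intro: order_trans)
qed

text \<open>
  A cover refining both \<open>D \<union> {c}\<close> and \<open>D \<union> {p}\<close> but not \<open>D\<close> has a member that is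
  below no element of \<open>D\<close>, hence below both \<open>c\<close> and \<open>p\<close>: nearness produces lower bounds.
\<close>
lemma near_pair_obtain:
  assumes "directed_family \<Phi>" "near_wrt P \<Phi> {c, p}"
  obtains D C x where "D \<subseteq> P" "D \<notin> coarsenings P \<Phi>" "C \<in> \<Phi>"
    "refines C (D \<union> {c})" "refines C (D \<union> {p})"
    "x \<in> C" "\<not> refines {x} D" "x \<le> c" "x \<le> p"
proof -
  obtain D where D: "D \<subseteq> P" "D \<notin> coarsenings P \<Phi>" "D \<union> {c} \<in> coarsenings P \<Phi>"
      "D \<union> {p} \<in> coarsenings P \<Phi>"
    using assms(2) by (auto simp: near_wrt_def)
  obtain A B where AB: "A \<in> \<Phi>" "refines A (D \<union> {c})" "B \<in> \<Phi>" "refines B (D \<union> {p})"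
    using D by (auto simp: coarsenings_def)
  obtain C where C: "C \<in> \<Phi>" "refines C A" "refines C B"
    using assms(1) AB unfolding directed_family_iff by blast
  have ref: "refines C (D \<union> {c})" "refines C (D \<union> {p})"
    using C AB refines_trans by blast+
  have "\<not> refines C D"
    using D(1,2) C(1) by (auto simp: coarsenings_def)
  then obtain x where x: "x \<in> C" "\<not> refines {x} D"
    by (auto simp: refines_def)
  then have "x \<le> c" "x \<le> p"
    using ref by (auto simp: refines_def)
  then show thesis
    using that D(1,2) C(1) ref x by blast
qed

section \<open>Admissible directed families\<close>

locale admissible_directed =
  fixes P :: "'a::order set" and \<Theta> :: "'a set set"
  assumes sub: "\<Theta> \<subseteq> Pow P"
    and admissible: "admissible_family P \<Theta>"
    and directed: "directed_family \<Theta>"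
begin

abbreviation near :: "'a \<Rightarrow> 'a \<Rightarrow> bool"
  where "near c p \<equiv> near_wrt P \<Theta> {c, p}"

abbreviation below :: "'a \<Rightarrow> 'a \<Rightarrow> bool"  (infix \<open>\<lhd>\<close> 50)
  where "p \<lhd> q \<equiv> uniformly_below P \<Theta> p q"

abbreviation "\<Phi> \<equiv> regularisation P \<Theta>"

lemma \<Theta>_nonempty: "\<Theta> \<noteq> {}"
  using directed by (auto simp: directed_family_iff)

lemma \<Theta>_subset: "C \<in> \<Theta> \<Longrightarrow> C \<subseteq> P"
  using sub by auto

lemma below_carrier: "p \<lhd> q \<Longrightarrow> p \<in> P \<and> q \<in> P"
  by (simp add: uniformly_below_def)

lemma below_le: "p \<lhd> q \<Longrightarrow> p \<le> q"
  using admissible below_carrier[of p q]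
  by (auto simp: admissible_family_def isLub_def leastP_def isUb_def setle_def)

lemma le_if_below_le: 
  assumes "p \<in> P" "x \<in> P" "\<And>q. q \<lhd> p \<Longrightarrow> q \<le> x"
  shows "p \<le> x"
proof -
  have "isLub P {q \<in> P. q \<lhd> p} p"
    using admissible assms(1) by (auto simp: admissible_family_def)
  moreover have "isUb P {q \<in> P. q \<lhd> p} x"
    using assms by (auto simp: isUb_def setle_def)
  ultimately show ?thesis
    by (auto simp: isLub_def leastP_def setge_def)
qed

lemma below_mono:
  assumes "p \<lhd> q" "p' \<le> p" "q \<le> q'" "p' \<in> P" "q' \<in> P"
  shows "p' \<lhd> q'"
proof -
  obtain C where C: "C \<in> \<Theta>" "\<forall>c\<in>star P \<Theta> C p. c \<le> q"
    using assms(1) by (auto simp: uniformly_below_def)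
  have "\<forall>c\<in>star P \<Theta> C p'. c \<le> q"
    using star_bound_refine[OF C(2) refines_refl \<Theta>_subset[OF C(1)]] assms below_carrier by blast
  then show ?thesis
    using C(1) assms order_trans unfolding uniformly_below_def by blast
qed

text \<open>
  The star of a point that is not near is empty, so the point is uniformly below everything. A poset
  therefore has at most one such point, its minimum.
\<close>
lemma not_near_point_min:
  assumes "p \<in> P" "p \<notin> near_points P \<Theta>" "q \<in> P"
  shows "p \<le> q"
proof -
  obtain C where "C \<in> \<Theta>" using \<Theta>_nonempty by blast
  moreover have "star P \<Theta> C p = {}"
    using assms near_points_near by (auto simp: star_def)
  ultimately have "p \<lhd> q"
    using assms by (auto simp: uniformly_below_def)
  then show ?thesis by (rule below_le)
qed

text \<open>
  Adding a minimum to a nonempty set changes nothing up to refinement, so the set \<open>D\<close> that shows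
  \<open>p\<close> to be near must be empty, and \<open>{p}\<close> itself is refined by a cover. This settles the
  degenerate case of a minimum that is near.
\<close>
lemma near_min_cover:
  assumes p: "p \<in> near_points P \<Theta>" and min: "\<And>q. q \<in> P \<Longrightarrow> p \<le> q"
  shows "\<exists>C\<in>\<Theta>. C \<subseteq> {p}"
proof -
  obtain D where D: "D \<subseteq> P" "D \<notin> coarsenings P \<Theta>" "D \<union> {p} \<in> coarsenings P \<Theta>"
    using p by (auto simp: near_points_def near_wrt_def)
  obtain C where C: "C \<in> \<Theta>" "refines C (D \<union> {p})"
    using D by (auto simp: coarsenings_def)
  have "D = {}"
  proof (rule ccontr)
    assume "D \<noteq> {}"
    then obtain d where "d \<in> D" by blast
    then have "refines (D \<union> {p}) D"
      using min D(1) unfolding refines_def by blast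
    with C(2) have "refines C D"
      by (rule refines_trans)
    then show False
      using D(1,2) C(1) by (auto simp: coarsenings_def)
  qed
  then have "c = p" if "c \<in> C" for c
    using C(2) that min[of c] \<Theta>_subset[OF C(1)] by (auto simp: refines_def intro: order.antisym)
  then show ?thesis using C(1) by blast
qed

text \<open>
  If no element of \<open>C\<close> were near \<open>p\<close>, then \<open>p\<close> would be uniformly below everything,
  hence a minimum that is near, and a common refinement with the trivial cover contains \<open>p\<close> itself.
\<close>
lemma cover_meets_near_point:
  assumes p: "p \<in> near_points P \<Theta>" and C: "C \<in> \<Theta>"
  shows "\<exists>c\<in>C. near c p"
proof (rule ccontr)
  assume none: "\<not> ?thesis"
  have "p \<in> P" using p near_points_subset by blast
  have min: "p \<le> q" if "q \<in> P" for q
  proof (rule below_le)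
    show "p \<lhd> q"
      using none C \<open>p \<in> P\<close> that by (auto simp: uniformly_below_def star_def)
  qed
  obtain C0 where C0: "C0 \<in> \<Theta>" "C0 \<subseteq> {p}"
    using near_min_cover[OF p min] by blast
  obtain E where E: "E \<in> \<Theta>" "refines E C0" "refines E C"
    using directed C C0 unfolding directed_family_iff by blast
  have "E \<noteq> {}"
    using p E(1) by (auto simp: near_points_def near_wrt_def coarsenings_def refines_def)
  then obtain e where "e \<in> E" by blast
  then obtain c where c: "c \<in> C" "e \<le> c"
    using E(3) by (auto simp: refines_def)
  have "e \<in> P" using \<open>e \<in> E\<close> E(1) \<Theta>_subset by blast
  then have "p \<le> c"
    using min c(2) order_trans by blast
  then have "near c p"
    using near_of_lower_bound[OF p, of c p] c(1) \<Theta>_subset[OF C] \<open>p \<in> P\<close> by blast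
  then show False using none c(1) by blast
qed

text \<open>
  This is stated for a family \<open>\<Psi>\<close> containing \<open>\<Theta>\<close> because it serves both for \<open>\<Theta>\<close> and
  for its regularisation. The lower bound from \<open>near_pair_obtain\<close> is near unless it is the minimum;
  then \<open>D\<close> is empty, a single cover refines \<open>{c}\<close> and \<open>{p}\<close>, and any of its near elements
  will do.
\<close>
lemma near_lower_bound:
  assumes \<Psi>: "directed_family \<Psi>" "\<Theta> \<subseteq> \<Psi>" "\<Psi> \<subseteq> Pow P"
    and meets: "\<And>C q. C \<in> \<Psi> \<Longrightarrow> q \<in> near_points P \<Theta> \<Longrightarrow> \<exists>c\<in>C. near c q"
    and "near_wrt P \<Psi> {c, p}"
  shows "\<exists>r\<in>near_points P \<Theta>. r \<le> c \<and> r \<le> p"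
proof -
  obtain D C x where D: "D \<subseteq> P" "D \<notin> coarsenings P \<Psi>" and C: "C \<in> \<Psi>"
      "refines C (D \<union> {c})" "refines C (D \<union> {p})"
    and x: "x \<in> C" "\<not> refines {x} D" "x \<le> c" "x \<le> p"
    by (rule near_pair_obtain[OF \<Psi>(1) assms(5)])
  show ?thesis
  proof (cases "x \<in> near_points P \<Theta>")
    case True
    then show ?thesis using x by blast
  next
    case False
    have "x \<in> P" using x(1) C(1) \<Psi>(3) by blast
    then have "D = {}"
      using not_near_point_min[OF _ False] x(2) D(1) by (auto simp: refines_def)
    have "{} \<notin> coarsenings P \<Theta>"
      using D(2) \<open>D = {}\<close> \<Psi>(2) by (auto simp: coarsenings_def)
    have "near_points P \<Theta> \<noteq> {}"
    proof
      assume empty: "near_points P \<Theta> = {}"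
      have "P \<subseteq> {x}"
        using not_near_point_min empty \<open>x \<in> P\<close> order.antisym by blast
      obtain C0 where "C0 \<in> \<Theta>" using \<Theta>_nonempty by blast
      then have "{} \<union> {x} \<in> coarsenings P \<Theta>"
        using \<Theta>_subset \<open>P \<subseteq> {x}\<close> \<open>x \<in> P\<close> by (auto simp: coarsenings_def refines_def)
      then show False
        using False \<open>x \<in> P\<close> \<open>{} \<notin> coarsenings P \<Theta>\<close>
        unfolding near_points_def near_wrt_def by blast
    qed
    then obtain q y where "y \<in> C" "near y q"
      using meets[OF C(1)] by blast
    then have "y \<in> near_points P \<Theta>"
      using near_points_near by blast
    moreover have "y \<le> c" "y \<le> p"
      using \<open>y \<in> C\<close> C(2,3) \<open>D = {}\<close> by (auto simp: refines_def)
    ultimately show ?thesis by blast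
  qed
qed

text \<open>
  Nearness thus depends only on the order and on the set of near points, which is what allows it to
  be transferred to other families.
\<close>
lemma near_iff: "near c p \<longleftrightarrow> c \<in> P \<and> p \<in> P \<and> (\<exists>r\<in>near_points P \<Theta>. r \<le> c \<and> r \<le> p)"
proof
  assume "near c p"
  moreover have "c \<in> P" "p \<in> P"
    using \<open>near c p\<close> by (auto simp: near_wrt_def)
  ultimately show "c \<in> P \<and> p \<in> P \<and> (\<exists>r\<in>near_points P \<Theta>. r \<le> c \<and> r \<le> p)"
    using near_lower_bound[OF directed order_refl sub] cover_meets_near_point by blast
qed (use near_of_lower_bound in blast)

text \<open>
  By admissibility a near point with no near point uniformly below it is a supremum of minima,
  that is, the minimum itself, and then it is uniformly below itself.
\<close>
lemma near_point_below:
  assumes p: "p \<in> near_points P \<Theta>"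
  shows "\<exists>q\<in>near_points P \<Theta>. q \<lhd> p"
proof (rule ccontr)
  assume none: "\<not> ?thesis"
  have "p \<in> P" using p near_points_subset by blast
  have min: "p \<le> x" if "x \<in> P" for x
  proof (rule le_if_below_le[OF \<open>p \<in> P\<close> that])
    fix q assume "q \<lhd> p"
    then show "q \<le> x"
      using none not_near_point_min below_carrier that by blast
  qed
  then obtain C where "C \<in> \<Theta>" "C \<subseteq> {p}"
    using near_min_cover[OF p] by blast
  then have "p \<lhd> p"
    using \<open>p \<in> P\<close> by (auto simp: uniformly_below_def star_def)
  then show False using none p by blast
qed

section \<open>The regularisation\<close>

lemma reg_iterate_subset: "C \<in> reg_iterate P \<Theta> n \<Longrightarrow> C \<subseteq> P"
  using \<Theta>_subset by (cases n) (auto simp: below_set_def)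

lemma refines_below_set: "refines (below_set P \<Theta> C) C"
  using below_le by (auto simp: refines_def below_set_def)

lemma below_set_mono: 
  assumes "refines C D" "D \<subseteq> P"
  shows "below_set P \<Theta> C \<subseteq> below_set P \<Theta> D"
proof
  fix p assume "p \<in> below_set P \<Theta> C"
  then obtain c where "p \<in> P" "c \<in> C" "p \<lhd> c"
    by (auto simp: below_set_def)
  moreover obtain d where "d \<in> D" "c \<le> d"
    using assms(1) \<open>c \<in> C\<close> by (auto simp: refines_def)
  ultimately show "p \<in> below_set P \<Theta> D"
    using below_mono[of p c p d] assms(2) by (auto simp: below_set_def)
qed

lemma refines_subset: "C \<subseteq> D \<Longrightarrow> refines C D"
  by (auto simp: refines_def)

lemma reg_iterate_refine:
  assumes "C \<in> reg_iterate P \<Theta> m" "m \<le> n"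
  shows "\<exists>E\<in>reg_iterate P \<Theta> n. refines E C"
  using assms(2)
proof (induction n rule: dec_induct)
  case base
  then show ?case using assms(1) refines_refl by blast
next
  case (step n)
  then obtain E where "E \<in> reg_iterate P \<Theta> n" "refines E C" by blast
  then show ?case
    using refines_trans[OF refines_below_set] by (intro bexI[of _ "below_set P \<Theta> E"]) auto
qed

lemma reg_iterate_directed: "directed_family (reg_iterate P \<Theta> n)"
proof (induction n)
  case 0
  then show ?case using directed by simp
next
  case (Suc n)
  show ?case
    unfolding directed_family_iff
  proof (intro conjI ballI)
    show "reg_iterate P \<Theta> (Suc n) \<noteq> {}"
      using Suc by (auto simp: directed_family_iff)
    fix C' D' assume "C' \<in> reg_iterate P \<Theta> (Suc n)" "D' \<in> reg_iterate P \<Theta> (Suc n)"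
    then obtain C D where CD: "C \<in> reg_iterate P \<Theta> n" "C' = below_set P \<Theta> C"
        "D \<in> reg_iterate P \<Theta> n" "D' = below_set P \<Theta> D"
      by auto
    obtain E where E: "E \<in> reg_iterate P \<Theta> n" "refines E C" "refines E D"
      using Suc CD unfolding directed_family_iff by blast
    have "refines (below_set P \<Theta> E) C'" "refines (below_set P \<Theta> E) D'"
      using below_set_mono[OF E(2) reg_iterate_subset[OF CD(1)]]
        below_set_mono[OF E(3) reg_iterate_subset[OF CD(3)]] CD(2,4)
      by (simp_all add: refines_subset)
    moreover have "below_set P \<Theta> E \<in> reg_iterate P \<Theta> (Suc n)"
      using E(1) by simp
    ultimately show "\<exists>E\<in>reg_iterate P \<Theta> (Suc n). refines E C' \<and> refines E D'"
      by blast
  qed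
qed

lemma reg_iterate_common:
  assumes "C \<in> reg_iterate P \<Theta> m" "D \<in> reg_iterate P \<Theta> n"
  shows "\<exists>E\<in>reg_iterate P \<Theta> (max m n). refines E C \<and> refines E D"
proof -
  obtain C' where C': "C' \<in> reg_iterate P \<Theta> (max m n)" "refines C' C"
    using reg_iterate_refine[OF assms(1) max.cobounded1] by blast
  obtain D' where D': "D' \<in> reg_iterate P \<Theta> (max m n)" "refines D' D"
    using reg_iterate_refine[OF assms(2) max.cobounded2] by blast
  obtain E where E: "E \<in> reg_iterate P \<Theta> (max m n)" "refines E C'" "refines E D'"
    using reg_iterate_directed[of "max m n"] C'(1) D'(1) unfolding directed_family_iff by blast
  show ?thesis
    using E(1) refines_trans[OF E(2) C'(2)] refines_trans[OF E(3) D'(2)] by blast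
qed

lemma in_regularisation: "C \<in> \<Phi> \<longleftrightarrow> (\<exists>n. C \<in> reg_iterate P \<Theta> n)"
  by (simp add: regularisation_def)

lemma \<Theta>_regularisation: "\<Theta> \<subseteq> \<Phi>"
proof
  fix C assume "C \<in> \<Theta>"
  then have "C \<in> reg_iterate P \<Theta> 0" by simp
  then show "C \<in> \<Phi>" unfolding in_regularisation by blast
qed

lemma regularisation_subset: "\<Phi> \<subseteq> Pow P"
  by (auto simp: in_regularisation dest!: reg_iterate_subset)

lemma below_set_regularisation: "C \<in> \<Phi> \<Longrightarrow> below_set P \<Theta> C \<in> \<Phi>"
  unfolding in_regularisation
proof (elim exE)
  fix n assume "C \<in> reg_iterate P \<Theta> n"
  then have "below_set P \<Theta> C \<in> reg_iterate P \<Theta> (Suc n)" by simp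
  then show "\<exists>n. below_set P \<Theta> C \<in> reg_iterate P \<Theta> n" by blast
qed

lemma regularisation_directed: "directed_family \<Phi>"
  unfolding directed_family_iff
proof (intro conjI ballI)
  show "\<Phi> \<noteq> {}"
    using \<Theta>_nonempty \<Theta>_regularisation by blast
  fix C D assume "C \<in> \<Phi>" "D \<in> \<Phi>"
  then obtain m n where "C \<in> reg_iterate P \<Theta> m" "D \<in> reg_iterate P \<Theta> n"
    by (auto simp: in_regularisation)
  then obtain E where "E \<in> reg_iterate P \<Theta> (max m n)" "refines E C \<and> refines E D"
    using reg_iterate_common by blast
  then show "\<exists>E\<in>\<Phi>. refines E C \<and> refines E D"
    using in_regularisation by blast
qed

text \<open>
  Each step of the regularisation shrinks the elements of a cover, but they remain close enough: a
  near point below \<open>b\<close> and \<open>p\<close> has a further near point uniformly below it.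
\<close>
lemma regularisation_meets_near_point:
  assumes "C \<in> \<Phi>" "p \<in> near_points P \<Theta>"
  shows "\<exists>c\<in>C. near c p"
proof -
  have "\<exists>c\<in>C. near c p" if "C \<in> reg_iterate P \<Theta> n" for n
    using that
  proof (induction n arbitrary: C)
    case 0
    then show ?case using cover_meets_near_point[OF assms(2), of C] by auto
  next
    case (Suc n)
    then obtain B where B: "B \<in> reg_iterate P \<Theta> n" "C = below_set P \<Theta> B" by auto
    obtain b where b: "b \<in> B" "near b p"
      using Suc.IH[OF B(1)] by blast
    then obtain r where r: "r \<in> near_points P \<Theta>" "r \<le> b" "r \<le> p"
      by (auto simp: near_iff)
    then obtain s where s: "s \<in> near_points P \<Theta>" "s \<lhd> r"
      using near_point_below by blast
    have P: "s \<in> P" "b \<in> P" "p \<in> P"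
      using b(2) below_carrier[OF s(2)] by (auto simp: near_wrt_def)
    have "s \<lhd> b"
      by (rule below_mono[OF s(2) order_refl r(2) P(1,2)])
    then have "s \<in> C"
      unfolding B(2) below_set_def using P(1) b(1) by blast
    moreover have "s \<le> p"
      using below_le[OF s(2)] r(3) by (rule order_trans)
    then have "near s p"
      by (rule near_of_lower_bound[OF s(1) order_refl _ P(1,3)])
    ultimately show ?case by blast
  qed
  then show ?thesis
    using assms(1)[unfolded in_regularisation] by blast
qed

text \<open>
  The regularisation has more covers, which makes it easier both for \<open>D \<union> {s}\<close> to be a coarsening
  and for \<open>D\<close> to be one, so neither direction is automatic. Left to right, the lower bound argument
  still applies because every regularised cover has an element near any given near point. Right to left, it suffices to show that a
  near point \<open>r\<close> stays near.
\<close>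
lemma regularisation_near: "near_wrt P \<Phi> {c, p} \<longleftrightarrow> near c p"
proof
  assume A: "near_wrt P \<Phi> {c, p}"
  then have "c \<in> P" "p \<in> P"
    by (auto simp: near_wrt_def)
  then show "near c p"
    using near_lower_bound[OF regularisation_directed \<Theta>_regularisation regularisation_subset
        regularisation_meets_near_point A]
    by (auto simp: near_iff)
next
  assume "near c p"
  then obtain r where r: "r \<in> near_points P \<Theta>" "r \<le> c" "r \<le> p" and cp: "c \<in> P" "p \<in> P"
    by (auto simp: near_iff)
  obtain q where q: "q \<in> near_points P \<Theta>" "q \<lhd> r"
    using near_point_below[OF r(1)] by blast
  obtain C where C: "C \<in> \<Theta>" "\<forall>c\<in>star P \<Theta> C q. c \<le> r"
    using q(2) by (auto simp: uniformly_below_def)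
  \<comment> \<open>Adding \<open>r\<close> makes up for the removed star of \<open>q\<close>; without it nothing in \<open>D\<close> is near \<open>q\<close>.\<close>
  define D where "D = C - star P \<Theta> C q"
  have rP: "r \<in> P" using r(1) near_points_subset by blast
  have qP: "q \<in> P" using q(1) near_points_subset by blast
  have DP: "D \<subseteq> P" using \<Theta>_subset[OF C(1)] by (auto simp: D_def)
  have "D \<union> {r} \<in> coarsenings P \<Phi>"
    using C DP rP \<Theta>_regularisation by (auto simp: coarsenings_def refines_def D_def)
  moreover have "D \<notin> coarsenings P \<Phi>"
  proof
    assume "D \<in> coarsenings P \<Phi>"
    then obtain B where B: "B \<in> \<Phi>" "refines B D"
      by (auto simp: coarsenings_def)
    obtain b where b: "b \<in> B" "near b q"
      using regularisation_meets_near_point[OF B(1) q(1)] by blast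
    then obtain d where d: "d \<in> D" "b \<le> d"
      using B(2) by (auto simp: refines_def)
    have "near d q"
      by (rule near_wrt_mono[OF b(2) d(2) order_refl]) (use d(1) DP qP in auto)
    then show False
      using d(1) by (auto simp: D_def star_def)
  qed
  ultimately have "r \<in> near_points P \<Phi>"
    using DP rP by (auto simp: near_points_def near_wrt_def)
  then show "near_wrt P \<Phi> {c, p}"
    by (rule near_of_lower_bound[OF _ r(2,3) cp])
qed

lemma regularisation_star: "star P \<Phi> C p = star P \<Theta> C p"
  unfolding star_def regularisation_near ..

lemma regularisation_near_points: "near_points P \<Phi> = near_points P \<Theta>"
  by (intro set_eqI) (simp only: near_points_self regularisation_near)

text \<open>
  This is the content of admissibility for the regularisation: a star of \<open>q\<close> bounded by \<open>p\<close>
  forces \<open>q \<le> p\<close>, however often the cover was regularised. For a cover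
  \<open>below_set P \<Theta> E\<close>, pass to some \<open>s \<lhd> q\<close> and to a refinement \<open>F\<close> of \<open>E\<close> so fine
  that the star of \<open>s\<close> in \<open>F\<close> lies below \<open>q\<close>. Each \<open>f\<close> in that star is the supremum
  of the \<open>g \<lhd> f\<close>. These belong to the regularised cover, and those that are near points are near
  \<open>q\<close>, being below it. So \<open>p\<close> bounds the star of \<open>s\<close> in \<open>F\<close>, which is one regularisation step earlier.
\<close>
lemma le_of_star_bound:
  assumes "C \<in> reg_iterate P \<Theta> n" "q \<in> P" "p \<in> P" "\<forall>c\<in>star P \<Theta> C q. c \<le> p"
  shows "q \<le> p"
  using assms
proof (induction n arbitrary: C q)
  case 0
  then have "q \<lhd> p" by (auto simp: uniformly_below_def)
  then show ?case by (rule below_le)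
next
  case (Suc n)
  obtain E where E: "E \<in> reg_iterate P \<Theta> n" "C = below_set P \<Theta> E"
    using Suc.prems(1) by auto
  show ?case
  proof (rule le_if_below_le[OF Suc.prems(2,3)])
    fix s assume s: "s \<lhd> q"
    then obtain B where B: "B \<in> \<Theta>" "\<forall>b\<in>star P \<Theta> B s. b \<le> q"
      by (auto simp: uniformly_below_def)
    have sP: "s \<in> P" using s below_carrier by blast
    obtain F where F: "F \<in> reg_iterate P \<Theta> n" "refines F E" "refines F B"
      using reg_iterate_common[OF E(1), of B 0] B(1) by (simp only: reg_iterate.simps max_0R) blast
    have Fq: "\<forall>f\<in>star P \<Theta> F s. f \<le> q"
      using star_bound_refine[OF B(2) F(3) \<Theta>_subset[OF B(1)] sP order_refl] .
    have "f \<le> p" if f: "f \<in> star P \<Theta> F s" for f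
    proof -
      have fF: "f \<in> F" "f \<in> P" "f \<le> q"
        using f Fq reg_iterate_subset[OF F(1)] by (auto simp: star_def)
      obtain e where e: "e \<in> E" "f \<le> e"
        using F(2) fF(1) by (auto simp: refines_def)
      have eP: "e \<in> P" using e(1) reg_iterate_subset[OF E(1)] by blast
      show ?thesis
      proof (rule le_if_below_le[OF fF(2) Suc.prems(3)])
        fix g assume g: "g \<lhd> f"
        have gP: "g \<in> P" using g below_carrier by blast
        have "g \<in> C"
          using below_mono[OF g order_refl e(2) gP eP] gP e(1) E(2) by (auto simp: below_set_def)
        \<comment> \<open>Only the minimum of the poset can fail to be near.\<close>
        show "g \<le> p"
        proof (cases "g \<in> near_points P \<Theta>")
          case True
          have "g \<le> q" using below_le[OF g] fF(3) by (rule order_trans)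
          then have "near g q"
            by (rule near_of_lower_bound[OF True order_refl _ gP Suc.prems(2)])
          then show ?thesis
            using Suc.prems(4) \<open>g \<in> C\<close> by (auto simp: star_def)
        next
          case False
          then show ?thesis by (rule not_near_point_min[OF gP _ Suc.prems(3)])
        qed
      qed
    qed
    then show "s \<le> p"
      using Suc.IH[OF F(1) sP Suc.prems(3)] by blast
  qed
qed

lemma regularisation_admissible: "admissible_family P \<Phi>"
  unfolding admissible_family_def
proof
  fix p assume p: "p \<in> P"
  have "q \<le> p" if "uniformly_below P \<Phi> q p" for q
    using that le_of_star_bound p
    by (auto simp: uniformly_below_def in_regularisation regularisation_star)
  moreover have "uniformly_below P \<Phi> q p" if "q \<lhd> p" for q
    using that \<Theta>_regularisation by (auto simp: uniformly_below_def regularisation_star)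
  ultimately show "isLub P {q \<in> P. uniformly_below P \<Phi> q p} p"
    using le_if_below_le[OF p] p below_carrier
    by (auto simp: isLub_def leastP_def isUb_def setle_def setge_def)
qed

section \<open>The spectrum of the regularisation\<close>

text \<open>
  A point of \<open>R\<close> that is not near would be the minimum, so \<open>R\<close> would be the whole poset and
  roundness would provide a cover inside \<open>{p}\<close>. As \<open>p\<close> is not near, the empty set would then
  be a coarsening, contradicting that \<open>R\<close> is Cauchy.
\<close>
lemma regularisation_spectrum_near_points:
  assumes "R \<in> spectrum P \<Phi>"
  shows "R \<subseteq> near_points P \<Theta>"
proof
  fix p assume p: "p \<in> R"
  have R: "up_set P R" "round_wrt \<Phi> R" "cauchy_wrt \<Phi> R"
    using assms by (auto simp: spectrum_def)
  have pP: "p \<in> P" using R(1) p by (auto simp: up_set_def)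
  show "p \<in> near_points P \<Theta>"
  proof (rule ccontr)
    assume np: "p \<notin> near_points P \<Theta>"
    then have min: "p \<le> q" if "q \<in> P" for q
      using not_near_point_min pP that by blast
    then have "R = P"
      using R(1) p by (auto simp: up_set_def)
    then obtain C where C: "C \<in> \<Phi>" "\<forall>c\<in>C \<inter> P. c \<le> p"
      using R(2) p by (auto simp: round_wrt_def)
    have "C \<subseteq> P" using C(1) regularisation_subset by blast
    then have "{} \<union> {p} \<in> coarsenings P \<Phi>"
      using C pP by (auto simp: coarsenings_def refines_def)
    moreover have "p \<notin> near_points P \<Phi>"
      using np by (simp add: regularisation_near_points)
    ultimately have "{} \<in> coarsenings P \<Phi>"
      using pP unfolding near_points_def near_wrt_def by blast
    then have "{} \<in> \<Phi>"
      by (auto simp: coarsenings_def refines_def)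
    then show False
      using R(3) by (auto simp: cauchy_wrt_def)
  qed
qed

text \<open>
  Regularisation turns roundness into interpolation: choose a cover \<open>C\<close> whose elements in \<open>R\<close>
  are below every \<open>f \<in> F\<close>; since \<open>R\<close> also meets \<open>below_set P \<Theta> C\<close>, it contains some
  \<open>d\<close> uniformly below an element of \<open>C\<close>.
\<close>
lemma regularisation_spectrum_filter:
  assumes "R \<in> spectrum P \<Phi>" "finite F" "F \<subseteq> R"
  shows "\<exists>s\<in>R. \<forall>f\<in>F. s \<lhd> f"
proof -
  have R: "up_set P R" "round_wrt \<Phi> R" "cauchy_wrt \<Phi> R"
    using assms(1) by (auto simp: spectrum_def)
  have "\<forall>f\<in>F. \<exists>C\<in>\<Phi>. \<forall>c\<in>C \<inter> R. c \<le> f"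
    using R(2) assms(3) by (auto simp: round_wrt_def)
  then obtain B where B: "\<And>f. f \<in> F \<Longrightarrow> B f \<in> \<Phi>" "\<And>f c. f \<in> F \<Longrightarrow> c \<in> B f \<inter> R \<Longrightarrow> c \<le> f"
    by metis
  obtain C where C: "C \<in> \<Phi>" "\<And>f. f \<in> F \<Longrightarrow> refines C (B f)"
    using regularisation_directed[unfolded directed_family_def, rule_format, of "B ` F"] assms(2) B(1)
    by auto
  obtain d where d: "d \<in> below_set P \<Theta> C" "d \<in> R"
    using R(3) below_set_regularisation[OF C(1)] unfolding cauchy_wrt_def by blast
  then obtain c where c: "c \<in> C" "d \<lhd> c"
    by (auto simp: below_set_def)
  have cR: "c \<in> R"
    using R(1) d(2) c(2) below_le below_carrier by (auto simp: up_set_def)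
  have "d \<lhd> f" if f: "f \<in> F" for f
  proof -
    obtain b where b: "b \<in> B f" "c \<le> b"
      using C(2)[OF f] c(1) by (auto simp: refines_def)
    have "b \<in> R"
      using R(1) cR b set_mp[OF regularisation_subset B(1)[OF f]] unfolding up_set_def by blast
    then have "c \<le> f"
      using b B(2)[OF f] order_trans by blast
    then show ?thesis
      using below_mono[OF c(2) order_refl] R(1) f assms(3) d(2) by (auto simp: up_set_def)
  qed
  then show ?thesis using d(2) by blast
qed

lemma below_round:
  assumes "R \<subseteq> P"
    and near: "\<And>p q. p \<in> R \<Longrightarrow> q \<in> R \<Longrightarrow> near p q"
    and "\<And>p. p \<in> R \<Longrightarrow> \<exists>q\<in>R. q \<lhd> p"
  shows "round_wrt \<Phi> R"
  unfolding round_wrt_def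
proof
  fix r assume "r \<in> R"
  then obtain s where s: "s \<in> R" "s \<lhd> r"
    using assms(3) by blast
  then obtain C where C: "C \<in> \<Theta>" "\<forall>c\<in>star P \<Theta> C s. c \<le> r"
    by (auto simp: uniformly_below_def)
  have "c \<le> r" if "c \<in> C \<inter> R" for c
    using near[of c s] s(1) C(2) that by (auto simp: star_def)
  then show "\<exists>C\<in>\<Phi>. \<forall>c\<in>C \<inter> R. c \<le> r"
    using C(1) \<Theta>_regularisation by blast
qed

lemma spectrum_regularisation:
  "spectrum P \<Phi> = {R. R \<subseteq> near_points P \<Theta> \<and> cauchy_wrt \<Theta> R \<and> below_filter P \<Theta> R}"
proof (intro set_eqI iffI CollectI)
  fix R assume R: "R \<in> spectrum P \<Phi>"
  then have up: "up_set P R" and cauchy: "cauchy_wrt \<Phi> R"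
    by (auto simp: spectrum_def)
  have "F \<subseteq> R" if "s \<in> R" "\<forall>f\<in>F. s \<lhd> f" for F s
    using up that below_le below_carrier by (auto simp: up_set_def)
  then have "below_filter P \<Theta> R"
    unfolding below_filter_def
    using up regularisation_spectrum_filter[OF R] by (auto simp: up_set_def) 
  moreover have "cauchy_wrt \<Theta> R"
    using cauchy \<Theta>_regularisation by (auto simp: cauchy_wrt_def)
  ultimately show "R \<subseteq> near_points P \<Theta> \<and> cauchy_wrt \<Theta> R \<and> below_filter P \<Theta> R"
    using regularisation_spectrum_near_points[OF R] by blast
next
  fix R assume "R \<in> {R. R \<subseteq> near_points P \<Theta> \<and> cauchy_wrt \<Theta> R \<and> below_filter P \<Theta> R}"
  then have R: "R \<subseteq> near_points P \<Theta>" and cauchy: "cauchy_wrt \<Theta> R" and filt: "below_filter P \<Theta> R"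
    by auto
  have RP: "R \<subseteq> P" using R near_points_subset by blast
  have lower: "\<exists>s\<in>R. \<forall>f\<in>F. s \<lhd> f" if "finite F" "F \<subseteq> R" for F
    using filt that RP unfolding below_filter_def by blast
  have upper: "f \<in> R" if "s \<in> R" "s \<lhd> f" for s f
  proof -
    have "{f} \<subseteq> P" using that below_carrier by blast
    then show ?thesis
      using filt[unfolded below_filter_def, THEN conjunct2, rule_format, of "{f}"] that by auto
  qed
  have up: "up_set P R"
    unfolding up_set_def
  proof (intro conjI RP ballI impI)
    fix r p assume "r \<in> R" "p \<in> P" "r \<le> p"
    then obtain s where "s \<in> R" "s \<lhd> r"
      using lower[of "{r}"] by auto
    then show "p \<in> R"
      using upper below_mono[of s r s p] \<open>r \<le> p\<close> \<open>p \<in> P\<close> RP by blast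
  qed
  have near: "near p q" if pq: "p \<in> R" "q \<in> R" for p q
  proof -
    obtain s where s: "s \<in> R" "s \<lhd> p" "s \<lhd> q"
      using lower[of "{p, q}"] pq by auto
    then have "s \<in> near_points P \<Theta>" "p \<in> P" "q \<in> P"
      using R RP pq by auto
    then show ?thesis
      using near_of_lower_bound below_le[OF s(2)] below_le[OF s(3)] by blast
  qed
  have "round_wrt \<Phi> R"
  proof (rule below_round[OF RP near])
    show "\<exists>q\<in>R. q \<lhd> p" if "p \<in> R" for p
      using lower[of "{p}"] that by auto
  qed
  moreover have "cauchy_wrt \<Phi> R"
  proof -
    have "C \<inter> R \<noteq> {}" if "C \<in> reg_iterate P \<Theta> n" for C n
      using that
    proof (induction n arbitrary: C)
      case 0
      then show ?case using cauchy by (auto simp: cauchy_wrt_def)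
    next
      case (Suc n)
      then obtain B where B: "B \<in> reg_iterate P \<Theta> n" "C = below_set P \<Theta> B" by auto
      obtain b where "b \<in> B" "b \<in> R" using Suc.IH[OF B(1)] by blast
      moreover obtain s where "s \<in> R" "s \<lhd> b"
        using lower[of "{b}"] \<open>b \<in> R\<close> by auto
      ultimately show ?case
        using B(2) RP by (auto simp: below_set_def)
    qed
    then show ?thesis
      by (auto simp: cauchy_wrt_def in_regularisation)
  qed
  ultimately show "R \<in> spectrum P \<Phi>"
    using up by (auto simp: spectrum_def)
qed

end

section \<open>The topology of the spectrum\<close>

lemma topspace_spectrum_topology: "topspace (spectrum_topology P \<Psi>) = spectrum P \<Psi>"
  by (auto simp: spectrum_topology_def)

lemma openin_spectrum_subbasis:
  "p \<in> P \<Longrightarrow> openin (spectrum_topology P \<Psi>) {R \<in> spectrum P \<Psi>. p \<in> R}"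
  unfolding spectrum_topology_def by (rule topology_generated_by_Basis) auto

lemma t0_space_spectrum_topology: "t0_space (spectrum_topology P \<Psi>)"
  unfolding t0_space_def topspace_spectrum_topology
proof (intro ballI impI)
  fix R S assume RS: "R \<in> spectrum P \<Psi>" "S \<in> spectrum P \<Psi>" "R \<noteq> S"
  then obtain p where p: "p \<in> R \<longleftrightarrow> p \<notin> S" by blast
  have "p \<in> P"
    using p RS by (auto simp: spectrum_def up_set_def)
  then show "\<exists>U. openin (spectrum_topology P \<Psi>) U \<and> (R \<notin> U \<longleftrightarrow> S \<in> U)"
    using p RS openin_spectrum_subbasis by (intro exI[of _ "{R \<in> spectrum P \<Psi>. p \<in> R}"]) auto
qed

context admissible_directed
begin

lemma regularisation_spectrum_upD:
  "R \<in> spectrum P \<Phi> \<Longrightarrow> r \<in> R \<Longrightarrow> r \<le> p \<Longrightarrow> p \<in> P \<Longrightarrow> p \<in> R"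
  by (auto simp: spectrum_def up_set_def)

lemma regularisation_spectrum_subset: "R \<in> spectrum P \<Phi> \<Longrightarrow> R \<subseteq> P"
  by (auto simp: spectrum_def up_set_def)

lemma regularisation_spectrum_near:
  assumes "R \<in> spectrum P \<Phi>" "p \<in> R" "q \<in> R"
  shows "near p q"
proof -
  obtain s where s: "s \<in> R" "s \<lhd> p" "s \<lhd> q"
    using regularisation_spectrum_filter[OF assms(1), of "{p, q}"] assms(2,3) by auto
  show ?thesis
    by (rule near_of_lower_bound[of s])
      (use regularisation_spectrum_near_points[OF assms(1)] s below_le below_carrier in auto)
qed

text \<open>
  Since \<open>R\<close> is a filter, the subbasic open sets are already a base.
\<close>
lemma regularisation_spectrum_base:
  assumes "openin (spectrum_topology P \<Phi>) W" "R \<in> W"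
  shows "\<exists>p\<in>R. {S \<in> spectrum P \<Phi>. p \<in> S} \<subseteq> W"
proof -
  have "generate_topology_on (insert (spectrum P \<Phi>) ((\<lambda>p. {R \<in> spectrum P \<Phi>. p \<in> R}) ` P)) W"
    using assms(1) unfolding spectrum_topology_def by (rule openin_topology_generated_by)
  then show ?thesis
    using assms(2)
  proof (induction W)
    case Empty
    then show ?case by simp
  next
    case (Int A B)
    then obtain p q where p: "p \<in> R" "{S \<in> spectrum P \<Phi>. p \<in> S} \<subseteq> A"
      and q: "q \<in> R" "{S \<in> spectrum P \<Phi>. q \<in> S} \<subseteq> B"
      by auto
    have R: "R \<in> spectrum P \<Phi>"
      using Int openin_subset[of "spectrum_topology P \<Phi>" A]
      unfolding spectrum_topology_def openin_topology_generated_by_iff by auto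
    obtain s where s: "s \<in> R" "s \<lhd> p" "s \<lhd> q"
      using regularisation_spectrum_filter[OF R, of "{p, q}"] p q by auto
    have "p \<in> S \<and> q \<in> S" if "S \<in> spectrum P \<Phi>" "s \<in> S" for S
      using that s below_le below_carrier regularisation_spectrum_upD by blast
    then show ?case
      using s(1) p(2) q(2) by (intro bexI[of _ s]) auto
  next
    case (UN K)
    then obtain A where A: "A \<in> K" "R \<in> A" by blast
    then obtain p where "p \<in> R" "{S \<in> spectrum P \<Phi>. p \<in> S} \<subseteq> A"
      using UN.IH by blast
    then show ?case using A(1) by (intro bexI[of _ p]) auto
  next
    case (Basis A)
    then consider "A = spectrum P \<Phi>" | p where "A = {R \<in> spectrum P \<Phi>. p \<in> R}" by blast
    then show ?case
    proof cases
      case 1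
      then obtain s where "s \<in> R"
        using regularisation_spectrum_filter[of R "{}"] Basis by auto
      then show ?thesis using 1 by auto
    next
      case 2
      then show ?thesis using Basis by auto
    qed
  qed
qed

text \<open>
  A decreasing sequence in \<open>R\<close> that gets below a member of each \<open>C n\<close> that lies in \<open>R\<close>.
  When \<open>C\<close> enumerates all covers, roundness makes it coinitial in \<open>R\<close>.
\<close>
lemma regularisation_spectrum_descent:
  fixes C :: "nat \<Rightarrow> 'a set"
  assumes C: "range C \<subseteq> \<Phi>" and R: "R \<in> spectrum P \<Phi>"
  shows "\<exists>r. \<forall>n. (r n \<in> R \<and> (\<exists>c\<in>C n \<inter> R. r n \<le> c)) \<and> r (Suc n) \<le> r n"
proof (rule dependent_nat_choice)
  have meet: "C n \<inter> R \<noteq> {}" for n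
    using C R by (auto simp: spectrum_def cauchy_wrt_def)
  show "\<exists>x. x \<in> R \<and> (\<exists>c\<in>C 0 \<inter> R. x \<le> c)"
    using meet[of 0] by blast
  fix x n assume x: "x \<in> R \<and> (\<exists>c\<in>C n \<inter> R. x \<le> c)"
  obtain c where c: "c \<in> C (Suc n) \<inter> R"
    using meet by blast
  obtain s where "s \<in> R" "s \<lhd> x" "s \<lhd> c"
    using regularisation_spectrum_filter[OF R, of "{x, c}"] x c by auto
  then show "\<exists>y. (y \<in> R \<and> (\<exists>c\<in>C (Suc n) \<inter> R. y \<le> c)) \<and> y \<le> x"
    using c below_le by blast
qed

text \<open>
  The limit consists of the points above, in the sense of \<open>\<lhd>\<close>, points that eventually belong to
  \<open>\<sigma> n\<close>. Taking all points that eventually belong to \<open>\<sigma> n\<close> would give a Cauchy up-set that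
  need not be round; the strengthened condition gives roundness, and the Cauchy property survives
  because every \<open>below_set P \<Theta> C\<close> is a cover too.
\<close>
lemma regularisation_spectrum_limit:
  fixes \<sigma> :: "nat \<Rightarrow> 'a set"
  assumes \<sigma>: "range \<sigma> \<subseteq> spectrum P \<Phi>"
    and small: "\<And>C. C \<in> \<Phi> \<Longrightarrow> \<exists>c\<in>C. \<forall>\<^sub>F n in sequentially. c \<in> \<sigma> n"
  shows "\<exists>R. limitin (spectrum_topology P \<Phi>) \<sigma> R sequentially"
proof -
  define R where "R = {p \<in> P. \<exists>q. q \<lhd> p \<and> (\<forall>\<^sub>F n in sequentially. q \<in> \<sigma> n)}"
  have spec: "\<sigma> n \<in> spectrum P \<Phi>" for n
    using \<sigma> by auto
  have ev_up: "\<forall>\<^sub>F n in sequentially. p \<in> \<sigma> n"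
    if "\<forall>\<^sub>F n in sequentially. q \<in> \<sigma> n" "q \<lhd> p" for p q
    using that(1) by (rule eventually_mono)
      (use regularisation_spectrum_upD[OF spec] below_le[OF that(2)] below_carrier[OF that(2)] in blast)
  have R_ev: "\<forall>\<^sub>F n in sequentially. p \<in> \<sigma> n" if "p \<in> R" for p
    using that ev_up by (auto simp: R_def)
  have "up_set P R"
    unfolding up_set_def
  proof (intro conjI ballI impI)
    show "R \<subseteq> P" by (auto simp: R_def)
    fix r p assume rp: "r \<in> R" "p \<in> P" "r \<le> p"
    then obtain q where q: "q \<lhd> r" "\<forall>\<^sub>F n in sequentially. q \<in> \<sigma> n"
      by (auto simp: R_def)
    have "q \<lhd> p"
      by (rule below_mono[OF q(1) order_refl rp(3) _ rp(2)]) (use q(1) below_carrier in blast)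
    then show "p \<in> R"
      using q(2) rp(2) by (auto simp: R_def)
  qed
  moreover have "round_wrt \<Phi> R"
    unfolding round_wrt_def
  proof
    fix p assume "p \<in> R"
    then obtain q where q: "q \<lhd> p" "\<forall>\<^sub>F n in sequentially. q \<in> \<sigma> n"
      by (auto simp: R_def)
    then obtain C where C: "C \<in> \<Theta>" "\<forall>c\<in>star P \<Theta> C q. c \<le> p"
      by (auto simp: uniformly_below_def)
    have "c \<le> p" if c: "c \<in> C \<inter> R" for c
    proof -
      have "\<forall>\<^sub>F n in sequentially. c \<in> \<sigma> n \<and> q \<in> \<sigma> n"
        using R_ev[of c] c q(2) by (simp add: eventually_conj)
      then obtain n where "c \<in> \<sigma> n" "q \<in> \<sigma> n"
        using eventually_happens'[OF sequentially_bot] by blast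
      then have "near c q"
        by (rule regularisation_spectrum_near[OF spec])
      then show ?thesis
        using C(2) c by (auto simp: star_def)
    qed
    then show "\<exists>C\<in>\<Phi>. \<forall>c\<in>C \<inter> R. c \<le> p"
      using C(1) \<Theta>_regularisation by blast
  qed
  moreover have "cauchy_wrt \<Phi> R"
    unfolding cauchy_wrt_def
  proof
    fix C assume C: "C \<in> \<Phi>"
    obtain d where d: "d \<in> below_set P \<Theta> C" "\<forall>\<^sub>F n in sequentially. d \<in> \<sigma> n"
      using small[OF below_set_regularisation[OF C]] by blast
    then obtain c where "c \<in> C" "d \<lhd> c"
      by (auto simp: below_set_def)
    then have "c \<in> C \<inter> R"
      using d(2) below_carrier by (auto simp: R_def)
    then show "C \<inter> R \<noteq> {}" by blast
  qed
  ultimately have R: "R \<in> spectrum P \<Phi>"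
    by (simp add: spectrum_def)
  have "limitin (spectrum_topology P \<Phi>) \<sigma> R sequentially"
    unfolding limitin_def topspace_spectrum_topology
  proof (intro conjI R allI impI)
    fix U assume U: "openin (spectrum_topology P \<Phi>) U \<and> R \<in> U"
    then obtain p where p: "p \<in> R" "{S \<in> spectrum P \<Phi>. p \<in> S} \<subseteq> U"
      using regularisation_spectrum_base by blast
    show "\<forall>\<^sub>F n in sequentially. \<sigma> n \<in> U"
      using R_ev[OF p(1)] by (rule eventually_mono) (use p(2) spec in blast)
  qed
  then show ?thesis by blast
qed

text \<open>
  The decreasing sequences \<open>r R\<close> provide countable neighbourhood bases satisfying Frink's condition.
  Given \<open>n\<close>, pick \<open>s \<in> R\<close> with \<open>s \<lhd> r R n\<close>, witnessed by the cover \<open>C i\<close>, and \<open>j\<close>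
  with \<open>r R j \<le> s\<close>. From the index \<open>max i j\<close> on, a basic neighbourhood of \<open>S\<close> that meets the
  one of \<open>R\<close> is given by an element below some \<open>c \<in> C i\<close> near \<open>s\<close>, so \<open>c \<le> r R n\<close>.
\<close>
lemma regularisation_spectrum_completely_metrizable:
  assumes "countable \<Theta>"
  shows "completely_metrizable_space (spectrum_topology P \<Phi>)"
proof -
  have "countable (reg_iterate P \<Theta> n)" for n
    by (induction n) (simp_all add: assms)
  then have "countable \<Phi>"
    unfolding regularisation_def by (intro countable_UN) simp_all
  moreover have "\<Phi> \<noteq> {}"
    using regularisation_directed by (simp add: directed_family_iff)
  moreover define C where "C = from_nat_into \<Phi>"
  ultimately have C: "range C = \<Phi>"
    by (simp add: range_from_nat_into)
  let ?X = "spectrum P \<Phi>"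
  have "\<exists>r. \<forall>n. (r n \<in> R \<and> (\<exists>c\<in>C n \<inter> R. r n \<le> c)) \<and> r (Suc n) \<le> r n"
    if "R \<in> ?X" for R
    by (rule regularisation_spectrum_descent) (use C that in auto)
  then obtain r where r: "\<And>R. R \<in> ?X \<Longrightarrow>
      \<forall>n. (r R n \<in> R \<and> (\<exists>c\<in>C n \<inter> R. r R n \<le> c)) \<and> r R (Suc n) \<le> r R n"
    by metis
  have r_in: "r R n \<in> R" and r_C: "\<exists>c\<in>C n \<inter> R. r R n \<le> c" and r_Suc: "r R (Suc n) \<le> r R n"
    if "R \<in> ?X" for R n
    using r[OF that] by auto
  have r_P: "r R n \<in> P" if "R \<in> ?X" for R n
    using r_in[OF that] regularisation_spectrum_subset[OF that] by blast
  have r_anti: "r R n \<le> r R m" if "m \<le> n" "R \<in> ?X" for R m n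
    using that(1) by (rule lift_Suc_antimono_le[of "r R", rotated]) (rule r_Suc[OF that(2)])
  have r_cofinal: "\<exists>n. r R n \<le> p" if R: "R \<in> ?X" and p: "p \<in> R" for R p
  proof -
    obtain B where "B \<in> \<Phi>" and B: "\<forall>c\<in>B \<inter> R. c \<le> p"
      using R p by (auto simp: spectrum_def round_wrt_def)
    then obtain n where n: "B = C n" using C by blast
    obtain c where c: "c \<in> C n \<inter> R" "r R n \<le> c"
      using r_C[OF R] by blast
    then have "r R n \<le> p"
      using B n order_trans[of "r R n" c p] by blast
    then show ?thesis ..
  qed
  define V where "V n R = {S \<in> ?X. r R n \<in> S}" for n R
  have V_subset: "V n R \<subseteq> {S \<in> ?X. p \<in> S}" if "r R n \<le> p" "p \<in> P" for n R p
    using regularisation_spectrum_upD[OF _ _ that] by (auto simp: V_def)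
  show ?thesis
  proof (rule completely_metrizable_of_frink_bases[where V = V], unfold topspace_spectrum_topology)
    show "openin (spectrum_topology P \<Phi>) (V n R) \<and> R \<in> V n R" if "R \<in> ?X" for n R
      unfolding V_def using openin_spectrum_subbasis[OF r_P[OF that]] r_in[OF that] that by auto
    show "V (Suc n) R \<subseteq> V n R" if "R \<in> ?X" for n R
      using V_subset[OF r_Suc[OF that] r_P[OF that]] by (simp add: V_def)
    show "\<exists>n. V n R \<subseteq> W" if W: "openin (spectrum_topology P \<Phi>) W" "R \<in> W" for W R
    proof -
      have R: "R \<in> ?X"
        using openin_subset[OF W(1)] W(2) by (auto simp: topspace_spectrum_topology)
      obtain p where p: "p \<in> R" "{S \<in> ?X. p \<in> S} \<subseteq> W"
        using regularisation_spectrum_base[OF W] by blast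
      obtain n where n: "r R n \<le> p"
        using r_cofinal[OF R p(1)] by blast
      have "p \<in> P" using p(1) regularisation_spectrum_subset[OF R] by blast
      then have "V n R \<subseteq> {S \<in> ?X. p \<in> S}"
        by (rule V_subset[OF n])
      then show ?thesis using p(2) by blast
    qed
    show "\<exists>m. \<forall>S\<in>?X. V m R \<inter> V m S \<noteq> {} \<longrightarrow> V m S \<subseteq> V n R" if R: "R \<in> ?X" for n R
    proof -
      obtain s where s: "s \<in> R" "s \<lhd> r R n"
        using regularisation_spectrum_filter[OF R, of "{r R n}"] r_in[OF R] by auto
      obtain E where E: "E \<in> \<Theta>" "\<forall>e\<in>star P \<Theta> E s. e \<le> r R n"
        using s(2) by (auto simp: uniformly_below_def)
      obtain i where i: "E = C i"
        using E(1) \<Theta>_regularisation C by blast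
      obtain j where j: "r R j \<le> s"
        using r_cofinal[OF R s(1)] by blast
      have "V (max i j) S \<subseteq> V n R" if S: "S \<in> ?X" and meet: "V (max i j) R \<inter> V (max i j) S \<noteq> {}" for S
      proof -
        obtain T where T: "T \<in> ?X" "r R (max i j) \<in> T" "r S (max i j) \<in> T"
          using meet by (auto simp: V_def)
        obtain c where c: "c \<in> C i" "c \<in> S" "r S i \<le> c"
          using r_C[OF S, of i] by blast
        have "r S (max i j) \<le> c"
          using r_anti[OF max.cobounded1 S] c(3) by (rule order_trans)
        moreover have "c \<in> P"
          using c(2) regularisation_spectrum_subset[OF S] by blast
        ultimately have "c \<in> T"
          using regularisation_spectrum_upD[OF T(1,3)] by blast
        have "r R (max i j) \<le> s"
          using r_anti[OF max.cobounded2 R] j by (rule order_trans)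
        then have "s \<in> T"
          using regularisation_spectrum_upD[OF T(1,2)] below_carrier[OF s(2)] by blast
        have "near c s"
          using regularisation_spectrum_near[OF T(1) \<open>c \<in> T\<close> \<open>s \<in> T\<close>] .
        then have "c \<le> r R n"
          using E(2) c(1) i by (auto simp: star_def)
        then have "r S (max i j) \<le> r R n"
          using \<open>r S (max i j) \<le> c\<close> by (rule order_trans[rotated])
        from V_subset[OF this r_P[OF R]] show ?thesis
          by (simp add: V_def)
      qed
      then show ?thesis by blast
    qed
    show "\<exists>l. limitin (spectrum_topology P \<Phi>) \<sigma> l sequentially"
      if \<sigma>: "range \<sigma> \<subseteq> ?X" and ev: "\<And>k. \<exists>R\<in>?X. \<forall>\<^sub>F n in sequentially. \<sigma> n \<in> V k R"
      for \<sigma> :: "nat \<Rightarrow> 'a set"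
    proof (rule regularisation_spectrum_limit[OF \<sigma>])
      fix B assume B: "B \<in> \<Phi>"
      then obtain k where k: "B = C k" using C by blast
      obtain R where R: "R \<in> ?X" "\<forall>\<^sub>F n in sequentially. \<sigma> n \<in> V k R"
        using ev by blast
      obtain c where c: "c \<in> B" "c \<in> R" "r R k \<le> c"
        using r_C[OF R(1), of k] k by blast
      have "c \<in> P" using c(2) regularisation_spectrum_subset[OF R(1)] by blast
      have "\<forall>\<^sub>F n in sequentially. c \<in> \<sigma> n"
        using R(2) by (rule eventually_mono) (use V_subset[OF c(3) \<open>c \<in> P\<close>] in blast)
      then show "\<exists>c\<in>B. \<forall>\<^sub>F n in sequentially. c \<in> \<sigma> n"
        using c(1) by blast
    qed
  qed (fact t0_space_spectrum_topology)
qed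

end

theorem theorem11p5:
  fixes P :: "'a::order set" and \<Theta> :: "'a set set"
  assumes "\<Theta> \<subseteq> Pow P"
    and "admissible_family P \<Theta>"
    and "directed_family \<Theta>"
  shows "admissible_family P (regularisation P \<Theta>)
    \<and> directed_family (regularisation P \<Theta>)
    \<and> spectrum P (regularisation P \<Theta>) =
        {R. R \<subseteq> near_points P \<Theta> \<and> cauchy_wrt \<Theta> R \<and> below_filter P \<Theta> R}
    \<and> (countable \<Theta> \<longrightarrow>
        completely_metrizable_space (spectrum_topology P (regularisation P \<Theta>)))"
proof -
  interpret admissible_directed P \<Theta>
    using assms by unfold_locales
  show ?thesis
    using regularisation_admissible regularisation_directed spectrum_regularisation
      regularisation_spectrum_completely_metrizable by blast
qed

end
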